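(* Let $f(z)=\sum_{k\ge 0}\widehat f(k)z^k$ be a non-constant power series with real coefficients and positive radius of convergence, with $f(0)=1$, strongly positive at all sufficiently small $r>0$, with $\gcd L(f)=1$, $l=\min L(f)>1$ and $l\,\widehat f(l)=1$. Let $m=\lfloor l/2\rfloor$, let $$\epsilon_0=\max\left\{1-\frac{l}{l_j}:1\le j\le m\right\},$$ and let $\epsilon_0<\delta<1$. Let $k=k(n)$ be positive integers with $k\approx n^\delta$, and for all large $n$ let $r=r(n)>0$ be defined by $k=n\mu_f(r)$. Write $\mu=\mu_f(r)$, $\sigma=\sigma_f(r)$. Then, as $n\to\infty$, $\widehat{f^n}(k)$ has the asymptotic expansion $$\widehat{f^n}(k)\sim\frac{(f(r))^n}{r^k\sqrt{2\pi n\sigma}}\left(1+\sum_{\nu=1}^\infty\frac{c_\nu}{k^\nu}\right),\qquad c_\nu=\frac{(-1)^\nu\mu^\nu}{(2\sigma)^\nu\,\nu!}\left[\frac{\partial^{2\nu}}{\partial z^{2\nu}}\left(\phi(r,z)^{-\nu-1/2}\right)\right]_{z=0}.$$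
   Context: Notation: $\widehat f(k)$ is the coefficient of $z^k$ in $f(z)$ and $\widehat{f^n}(k)$ the coefficient of $z^k$ in $(f(z))^n$. $f$ is strongly positive at $r>0$ (with $r$ less than the radius of convergence) if $|f(re^{i\theta})|<f(r)$ for $0<\theta<2\pi$. $L(f)=\{k>0:\widehat f(k)\ne0\}$. For $1\le j\le m=\lfloor l/2\rfloor$, $l_j=\min\{k\in L(f): jk\not\equiv0\pmod l\}$ (this exists because $\gcd L(f)=1$). $\mu_f(r)=rf'(r)/f(r)$ and $\sigma_f(r)=r\mu_f'(r)$. As $r\to0^+$, $\mu_f(r)\to 0$, and $\mu_f$ is strictly increasing for small $r>0$; so if $k/n\to0$ the equation $k=n\mu_f(r)$ has, for large $n$, a unique small solution $r>0$, and $r\to0$ as $n\to\infty$. For small $r>0$ and $z\in\mathbb C$ near $0$ the function $\phi(r,z)$ is defined by $$\frac{f(re^z)}{f(r)}=\exp\left(\mu_f(r)z+\tfrac12\sigma_f(r)z^2\phi(r,z)\right)\ (z\ne0),\qquad \phi(r,0)=1,$$ i.e. $\phi(r,z)=\frac{2}{\sigma_f(r)z^2}\left(\log\frac{f(re^z)}{f(r)}-\mu_f(r)z\right)$ with the principal logarithm; it is analytic in $z$ near $0$. $g(n)\approx h(n)$ means $g=O(h)$ and $h=O(g)$ as $n\to\infty$. The coefficients $c_\nu$ depend on $r$ (hence on $n$); the asymptotic expansion means that for every $N\ge0$, $$r^k\sqrt{2\pi n\sigma}\,\frac{\widehat{f^n}(k)}{(f(r))^n}=1+\sum_{\nu=1}^{N}\frac{c_\nu}{k^\nu}+O\left(k^{-N-1}\right)\quad(n\to\infty).$$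 *)

theory Defs
  imports "HOL-Analysis.Analysis" "HOL-Library.Landau_Symbols"
begin

definition complex_fps :: "real fps \<Rightarrow> complex fps" where
  "complex_fps f = Abs_fps (\<lambda>k. complex_of_real (fps_nth f k))"

definition strongly_positive_at :: "real fps \<Rightarrow> real \<Rightarrow> bool" where
  "strongly_positive_at f r \<longleftrightarrow>
     0 < r \<and> ereal r < fps_conv_radius f \<and>
     (\<forall>\<theta>. 0 < \<theta> \<and> \<theta> < 2 * pi \<longrightarrow>
        norm (eval_fps (complex_fps f) (complex_of_real r * exp (\<i> * complex_of_real \<theta>)))
          < eval_fps f r)"

definition L_set :: "real fps \<Rightarrow> nat set" where
  "L_set f = {k. 0 < k \<and> fps_nth f k \<noteq> 0}"

text \<open>The sets whose minima are taken may be infinite, so \<open>LEAST\<close> is used instead of \<open>Min\<close>.\<close>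

definition min_L :: "real fps \<Rightarrow> nat" where
  "min_L f = (LEAST k. k \<in> L_set f)"

definition l_idx :: "real fps \<Rightarrow> nat \<Rightarrow> nat" where
  "l_idx f j = (LEAST k. k \<in> L_set f \<and> \<not> min_L f dvd j * k)"

definition eps0 :: "real fps \<Rightarrow> real" where
  "eps0 f = Max ((\<lambda>j. 1 - real (min_L f) / real (l_idx f j)) ` {1..min_L f div 2})"

definition mu_f :: "real fps \<Rightarrow> real \<Rightarrow> real" where
  "mu_f f r = r * deriv (eval_fps f) r / eval_fps f r"

definition sigma_f :: "real fps \<Rightarrow> real \<Rightarrow> real" where
  "sigma_f f r = r * deriv (mu_f f) r"

definition phi :: "real fps \<Rightarrow> real \<Rightarrow> complex \<Rightarrow> complex" where
  "phi f r z =
     (if z = 0 then 1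
      else 2 / (complex_of_real (sigma_f f r) * z\<^sup>2) *
           (Ln (eval_fps (complex_fps f) (complex_of_real r * exp z) / complex_of_real (eval_fps f r))
              - complex_of_real (mu_f f r) * z))"

definition c_coeff :: "real fps \<Rightarrow> real \<Rightarrow> nat \<Rightarrow> complex" where
  "c_coeff f r \<nu> =
     (- 1) ^ \<nu> * complex_of_real (mu_f f r) ^ \<nu> / ((2 * complex_of_real (sigma_f f r)) ^ \<nu> * fact \<nu>) *
     (deriv ^^ (2 * \<nu>)) (\<lambda>z. phi f r z powr (- of_nat \<nu> - 1 / 2)) 0"

end

theory Submission
  imports Defs "HOL-Complex_Analysis.Complex_Analysis" "HOL-Probability.Distributions"
    "HOL-Real_Asymp.Real_Asymp"
begin

text \<open>
  The proof is the saddle point method, carried out in the logarithm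
  \<open>h = log f = \<Sum> b\<^sub>k z\<^sup>k\<close>. Since \<open>f(r e\<^sup>z) = exp (h(r e\<^sup>z))\<close>, the functions \<open>\<mu>\<close> and \<open>\<sigma>\<close> are
  \<open>\<Sum> k b\<^sub>k r\<^sup>k\<close> and \<open>\<Sum> k\<^sup>2 b\<^sub>k r\<^sup>k\<close>, and Cauchy's formula on the circle of radius \<open>r\<close> turns the
  normalised coefficient into
  \<open>sqrt (n \<sigma> / 2\<pi>)\<close> times the integral over \<open>[-\<pi>, \<pi>]\<close> of
  \<open>exp (n (h(r e\<^sup>i\<^sup>\<theta>) - h(r) - i \<mu> \<theta>))\<close>. The choice of \<open>r\<close> removes the linear term at \<open>\<theta> = 0\<close>.

  Near \<open>\<theta> = 0\<close> the exponent is \<open>- n \<sigma> \<theta>\<^sup>2 \<phi>(r, i\<theta>) / 2\<close>. As \<open>r\<close> tends to \<open>0\<close>, the function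
  \<open>h(r e\<^sup>z) - h(r) - \<mu> z\<close> is at most of order \<open>r\<^sup>l\<close>, and \<open>\<sigma>\<close> is exactly of this order, so the functions \<open>\<phi>(r, _)\<close> are
  bounded on the unit disc uniformly in \<open>r\<close> (lemma \<open>phi_holomorphic_bounded\<close>). After the
  substitution \<open>x = sqrt (n \<sigma>) \<theta>\<close> one expands \<open>exp (- x\<^sup>2 (\<phi> - 1) / 2)\<close> in powers of \<open>\<phi> - 1\<close>,
  then these powers in Taylor series, and integrates against the normal density (lemma
  \<open>gaussian_saddle_expansion\<close>). The closed form of the coefficients comes from an identity
  between Gaussian moments and generalised binomial coefficients (lemma \<open>gbinomial_half_moment\<close>): the
  \<open>p\<close>-th power of \<open>\<phi> - 1\<close> enters the coefficient of \<open>(n \<sigma>)\<^sup>-\<^sup>\<nu>\<close> with exactly the weight it has in the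
  binomial series of \<open>\<phi> powr (- \<nu> - 1/2)\<close>.

  Away from \<open>\<theta> = 0\<close> the modulus of the integrand is governed by
  \<open>\<Sum> b\<^sub>k r\<^sup>k (cos k\<theta> - 1)\<close>. Its leading term, of order \<open>r\<^sup>l\<close>, vanishes at the angles \<open>2\<pi>j/l\<close>. There the
  first index \<open>k\<close> with \<open>b\<^sub>k \<noteq> 0\<close> and \<open>l\<close> not dividing \<open>jk\<close> takes over. This index is \<open>l\<^sub>j\<close>, because the
  indices \<open>k\<close> with \<open>l\<close> dividing \<open>jk\<close> are closed under addition (lemma
  \<open>log_fps_nth_outside_subgroup\<close>), and its coefficient is positive by strong positivity. Hence
  the sum is at most \<open>- c r\<^sup>L\<close> off the saddle, where \<open>L\<close> is the largest \<open>l\<^sub>j\<close> (lemma \<open>minor_arc_bound\<close>).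
  From \<open>k = n \<mu>\<close> the number \<open>n r\<^sup>L\<close> is at least of order \<open>n powr (1 - (1 - \<delta>) L / l)\<close>, and the
  hypothesis on \<open>\<delta>\<close> says that this exponent is positive. So the contribution of these
  angles is smaller than every power of \<open>k\<close>.
\<close>

section \<open>Gaussian integrals with an analytic perturbation\<close>

lemma norm_taylor_coeff_le:
  fixes g :: "complex \<Rightarrow> complex"
  assumes holo: "g holomorphic_on cball 0 R" and R: "R > 0"
    and bound: "\<And>z. norm z \<le> R \<Longrightarrow> norm (g z) \<le> M"
    and G: "g has_fps_expansion G"
  shows "norm (fps_nth G j) \<le> M / R ^ j"
proof -
  have "norm ((deriv ^^ j) g 0) \<le> fact j * M / R ^ j"
  proof (rule Cauchy_inequality)
    show "g holomorphic_on ball 0 R"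
      by (rule holomorphic_on_subset[OF holo]) auto
    show "continuous_on (cball 0 R) g"
      using holo by (rule holomorphic_on_imp_continuous_on)
  qed (use R bound in auto)
  then show ?thesis
    using R unfolding fps_nth_fps_expansion[OF G] by (simp add: norm_divide field_simps)
qed

text \<open>
  Cauchy's estimates dominate the tail of the Taylor series by a geometric series whose ratio is at
  most one half. The constant depends on the function only through its bound, which is what makes
  the later estimates uniform in \<open>r\<close>.
\<close>

lemma norm_taylor_remainder_le:
  fixes g :: "complex \<Rightarrow> complex"
  assumes holo: "g holomorphic_on cball 0 R" and R: "R > 0"
    and bound: "\<And>z. norm z \<le> R \<Longrightarrow> norm (g z) \<le> M"
    and G: "g has_fps_expansion G"
    and z: "norm z \<le> R / 2"
  shows "norm (g z - (\<Sum>j<K. fps_nth G j * z ^ j)) \<le> 2 * M * (norm z / R) ^ K"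
proof -
  define q where "q = norm z / R"
  have q: "0 \<le> q" "q \<le> 1 / 2"
    using z R by (auto simp: q_def field_simps)
  have M: "M \<ge> 0"
    using bound[of 0] R norm_ge_zero[of "g 0"] by (simp del: norm_ge_zero)
  have "(\<lambda>j. (deriv ^^ j) g 0 / fact j * (z - 0) ^ j) sums g z"
    by (rule holomorphic_power_series[of _ _ R])
       (use holomorphic_on_subset[OF holo ball_subset_cball] z R in auto)
  then have "(\<lambda>j. fps_nth G j * z ^ j) sums g z"
    by (simp add: fps_nth_fps_expansion[OF G])
  then have "(\<lambda>j. fps_nth G (j + K) * z ^ (j + K)) sums (g z - (\<Sum>j<K. fps_nth G j * z ^ j))"
    by (rule sums_split_initial_segment)
  moreover have "norm (fps_nth G (j + K) * z ^ (j + K)) \<le> M * q ^ K * (1 / 2) ^ j" for j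
  proof -
    have "norm (fps_nth G (j + K) * z ^ (j + K)) \<le> M / R ^ (j + K) * norm z ^ (j + K)"
      unfolding norm_mult norm_power
      by (intro mult_right_mono norm_taylor_coeff_le[OF holo R bound G]) auto
    also have "\<dots> = M * q ^ K * q ^ j"
      using R by (simp add: q_def power_divide power_add mult_ac)
    also have "\<dots> \<le> M * q ^ K * (1 / 2) ^ j"
      using q M by (intro mult_left_mono power_mono) auto
    finally show ?thesis .
  qed
  moreover have "(\<lambda>j. M * q ^ K * (1 / 2) ^ j) sums (M * q ^ K * 2)"
    using sums_mult[OF geometric_sums[of "1/2::real"], of "M * q ^ K"] by simp
  ultimately show ?thesis
    using norm_sums_le[of "\<lambda>j. fps_nth G (j + K) * z ^ (j + K)"] by (fastforce simp: q_def mult_ac)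
qed

text \<open>
  Half of the Gaussian exponent is kept in reserve: it absorbs the factor
  \<open>exp (x\<^sup>2 / 4)\<close> by which the perturbation of the exponent may enlarge the integrand.
\<close>

lemma integrable_gaussian_reserve:
  "integrable lborel (\<lambda>x. std_normal_density x * exp (x\<^sup>2 / 4) * (1 + \<bar>x\<bar>) ^ m)"
proof -
  have "std_normal_density x * exp (x\<^sup>2 / 4) = sqrt 2 * normal_density 0 (sqrt 2) x" for x
    using real_sqrt_mult[of 2 2]
    by (simp add: normal_density_def real_sqrt_mult field_simps flip: exp_add)
  moreover have "integrable lborel (\<lambda>x. \<Sum>i\<le>m. sqrt 2 * (of_nat (m choose i) *
                   (normal_density 0 (sqrt 2) x * \<bar>x - 0\<bar> ^ i)))"
    by (intro Bochner_Integration.integrable_sum integrable_mult_right integrable_normal_moment_abs) auto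
  moreover have "(\<Sum>i\<le>m. sqrt 2 * (of_nat (m choose i) * (normal_density 0 (sqrt 2) x * \<bar>x - 0\<bar> ^ i)))
                   = sqrt 2 * normal_density 0 (sqrt 2) x * (1 + \<bar>x\<bar>) ^ m" for x
    unfolding add.commute[of 1] binomial_ring by (simp add: sum_distrib_left mult_ac)
  ultimately show ?thesis
    by simp
qed

definition gaussian_moment :: "nat \<Rightarrow> real" where
  "gaussian_moment n = (if even n then fact n / (2 ^ (n div 2) * fact (n div 2)) else 0)"

lemma has_bochner_integral_gaussian_moment:
  "has_bochner_integral lborel (\<lambda>x. std_normal_density x * x ^ n) (gaussian_moment n)"
  using std_normal_moment_even[of "n div 2"] std_normal_moment_odd[of "n div 2"]
  by (cases "even n") (auto simp: gaussian_moment_def)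

lemma sum_lessThan_even:
  fixes a :: "nat \<Rightarrow> 'a :: comm_monoid_add"
  assumes "\<And>j. odd j \<Longrightarrow> a j = 0"
  shows "(\<Sum>j<2 * N + 2. a j) = (\<Sum>\<nu>\<le>N. a (2 * \<nu>))"
proof (induction N)
  case 0
  show ?case using assms[of 1] by (simp add: numeral_2_eq_2)
next
  case (Suc N)
  have "2 * Suc N + 2 = Suc (Suc (2 * N + 2))" by simp
  then show ?case using Suc assms[of "Suc (2 * N + 2)"] by simp
qed

text \<open>
  Both sides satisfy the same recurrence in \<open>p\<close>: the moments contribute a factor
  \<open>2p + 2\<nu> + 1\<close>, which is \<open>-2\<close> times the factor \<open>- \<nu> - 1/2 - p\<close> of the binomial coefficient.
\<close>

lemma gbinomial_half_moment:
  "(- 1 / 2) ^ p / fact p * complex_of_real (gaussian_moment (2 * p + 2 * \<nu>)) =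
     fact (2 * \<nu>) / (2 ^ \<nu> * fact \<nu>) * ((- of_nat \<nu> - 1 / 2) gchoose p)"
proof (induction p)
  case 0
  then show ?case by (simp add: gaussian_moment_def)
next
  case (Suc p)
  define m where "m = p + \<nu>"
  have m: "gaussian_moment (2 * Suc p + 2 * \<nu>) = (2 * real p + 2 * real \<nu> + 1) * gaussian_moment (2 * p + 2 * \<nu>)"
  proof -
    have "gaussian_moment (2 * Suc m) = (2 * real m + 1) * gaussian_moment (2 * m)"
      by (simp add: gaussian_moment_def divide_simps)
    then show ?thesis by (simp add: m_def algebra_simps)
  qed
  have "(- 1 / 2) ^ Suc p / fact (Suc p) * complex_of_real (gaussian_moment (2 * Suc p + 2 * \<nu>)) =
     ((- 1 / 2) ^ p / fact p * complex_of_real (gaussian_moment (2 * p + 2 * \<nu>))) *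
      ((- of_nat \<nu> - 1 / 2 - of_nat p) / of_nat (Suc p))"
    unfolding m by (simp add: divide_simps del: of_nat_Suc) (simp add: algebra_simps)
  also have "\<dots> = fact (2 * \<nu>) / (2 ^ \<nu> * fact \<nu>) * ((- of_nat \<nu> - 1 / 2) gchoose Suc p)"
    unfolding Suc.IH using gbinomial_mult_1[of "- complex_of_nat \<nu> - 1 / 2" p]
    by (simp add: field_simps del: of_nat_Suc)
  finally show ?case .
qed

text \<open>
  For \<open>\<psi> = \<phi> - 1\<close> this is the part of the coefficient \<open>c\<^sub>\<nu>\<close> that depends on \<open>\<phi>\<close> alone, the factor
  \<open>(\<mu> / \<sigma>)\<^sup>\<nu>\<close> being left out.
\<close>

definition saddle_coeff :: "(complex \<Rightarrow> complex) \<Rightarrow> nat \<Rightarrow> complex" where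
  "saddle_coeff \<psi> \<nu> = (- 1) ^ \<nu> / (2 ^ \<nu> * fact \<nu>) *
     (deriv ^^ (2 * \<nu>)) (\<lambda>z. (1 + \<psi> z) powr (- of_nat \<nu> - 1 / 2)) 0"

text \<open>
  The right-hand side is a coefficient of the binomial series composed with \<open>\<psi>\<close>. Powers of
  \<open>\<psi>\<close> beyond \<open>2\<nu>\<close> do not reach that coefficient, because \<open>\<psi>\<close> vanishes at the origin, so the series
  becomes a finite sum over any range that extends past \<open>2\<nu>\<close>.
\<close>

lemma saddle_coeff_eq_moments:
  assumes \<psi>: "\<psi> has_fps_expansion U" and U0: "fps_nth U 0 = 0" and P: "2 * \<nu> < P"
  shows "(\<Sum>p<P. (- 1 / 2) ^ p / fact p * fps_nth (U ^ p) (2 * \<nu>) * (\<i> ^ (2 * \<nu>)) *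
            of_real (gaussian_moment (2 * p + 2 * \<nu>))) = saddle_coeff \<psi> \<nu>"
proof -
  define a where "a = - complex_of_nat \<nu> - 1 / 2"
  have "((\<lambda>z. (1 + z) powr a) \<circ> \<psi>) has_fps_expansion (fps_binomial a oo U)"
    by (rule has_fps_expansion_compose[OF has_fps_expansion_binomial_complex \<psi> U0])
  then have "(\<lambda>z. (1 + \<psi> z) powr a) has_fps_expansion (fps_binomial a oo U)"
    by (simp add: o_def)
  from fps_nth_fps_expansion[OF this, of "2 * \<nu>"]
  have deriv: "(deriv ^^ (2 * \<nu>)) (\<lambda>z. (1 + \<psi> z) powr a) 0 =
      fact (2 * \<nu>) * (\<Sum>p=0..2*\<nu>. (a gchoose p) * fps_nth (U ^ p) (2 * \<nu>))"
    by (simp add: fps_compose_nth)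
  have "(\<Sum>p=0..2*\<nu>. (a gchoose p) * fps_nth (U ^ p) (2 * \<nu>)) =
        (\<Sum>p<P. (a gchoose p) * fps_nth (U ^ p) (2 * \<nu>))"
    using P by (intro sum.mono_neutral_left)
      (auto simp: startsby_zero_power_prefix[OF U0])
  then have "saddle_coeff \<psi> \<nu> = (\<Sum>p<P. (- 1) ^ \<nu> * fps_nth (U ^ p) (2 * \<nu>) *
      (fact (2 * \<nu>) / (2 ^ \<nu> * fact \<nu>) * (a gchoose p)))"
    unfolding saddle_coeff_def a_def[symmetric] deriv
    by (simp add: sum_distrib_left mult_ac)
  also have "\<dots> = (\<Sum>p<P. (- 1 / 2) ^ p / fact p * fps_nth (U ^ p) (2 * \<nu>) * (\<i> ^ (2 * \<nu>)) *
            of_real (gaussian_moment (2 * p + 2 * \<nu>)))"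
    unfolding a_def gbinomial_half_moment[symmetric]
    by (intro sum.cong refl) (simp add: power_mult[of \<i> 2 \<nu>] mult_ac)
  finally show ?thesis by simp
qed

text \<open>
  The exponential is replaced by its Taylor polynomial in \<open>\<psi>\<close>, and each power of \<open>\<psi>\<close> by its Taylor
  polynomial in \<open>z = i \<epsilon> x\<close>. On the range of integration both errors carry a factor
  \<open>\<epsilon>\<^sup>2\<^sup>N\<^sup>+\<^sup>2\<close>. Outside it the integrand is cut off, and the polynomial that remains is small there
  because \<open>\<epsilon> \<bar>x\<bar> / \<eta>\<close> is at least \<open>1\<close>, so that any power of it may be inserted. The
  polynomial can thus be integrated over the whole line, where its moments are known. The constant
  depends on \<open>\<psi>\<close> only through the bound \<open>M\<close>.
\<close>

lemma gaussian_saddle_expansion: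
  fixes M R \<eta> :: real and N :: nat
  assumes R: "R > 0" and \<eta>: "0 < \<eta>" "\<eta> \<le> R / 2"
  shows "\<exists>C. \<forall>\<psi> \<epsilon>. \<psi> holomorphic_on cball 0 R \<longrightarrow> (\<forall>z. norm z \<le> R \<longrightarrow> norm (\<psi> z) \<le> M) \<longrightarrow>
     \<psi> 0 = 0 \<longrightarrow> (\<forall>z. norm z \<le> \<eta> \<longrightarrow> norm (\<psi> z) \<le> 1 / 2) \<longrightarrow> 0 < \<epsilon> \<longrightarrow> \<epsilon> \<le> 1 \<longrightarrow>
     norm ((LINT x:{-\<eta>/\<epsilon>..\<eta>/\<epsilon>}|lborel. std_normal_density x *\<^sub>R exp (- ((of_real x)\<^sup>2 / 2) * \<psi> (\<i> * of_real (\<epsilon> * x))))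
        - (\<Sum>\<nu>\<le>N. saddle_coeff \<psi> \<nu> * of_real \<epsilon> ^ (2 * \<nu>))) \<le> C * \<epsilon> ^ (2 * N + 2)"
proof (cases "M \<ge> 0")
  case False
  then show ?thesis
    using R by (intro exI[of _ 0] allI impI) (metis norm_ge_zero norm_zero order_trans less_imp_le)
next
  case M: True
  \<comment> \<open>Both expansions are cut off at this order: the odd moments vanish, so the even orders up to
    \<open>2 * N\<close> are the ones that survive.\<close>
  define P where "P = 2 * N + 2"
  define wt where "wt x = std_normal_density x * exp (x\<^sup>2 / 4) * (1 + \<bar>x\<bar>) ^ (4 * P)" for x :: real
  \<comment> \<open>The three summands account for the Taylor error of the exponential, the Taylor errors of the
    powers of \<open>\<psi>\<close>, and the polynomial outside the range of integration.\<close>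
  define C1 where "C1 = (M / R) ^ P + (\<Sum>p<P. 2 * M ^ p / R ^ P) + (\<Sum>p<P. \<Sum>j<P. M ^ p / R ^ j / \<eta> ^ P)"
  have wt: "integrable lborel wt"
    unfolding wt_def by (rule integrable_gaussian_reserve)
  have P: "P > 0" by (simp add: P_def)
  show ?thesis
  proof (intro exI allI impI)
    fix \<psi> :: "complex \<Rightarrow> complex" and \<epsilon> :: real
    assume holo: "\<psi> holomorphic_on cball 0 R" and bd: "\<forall>z. norm z \<le> R \<longrightarrow> norm (\<psi> z) \<le> M"
      and \<psi>0: "\<psi> 0 = 0" and half: "\<forall>z. norm z \<le> \<eta> \<longrightarrow> norm (\<psi> z) \<le> 1 / 2"
      and \<epsilon>: "0 < \<epsilon>" "\<epsilon> \<le> 1"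
    define U where "U = fps_expansion \<psi> 0"
    have "\<psi> holomorphic_on ball 0 R"
      by (rule holomorphic_on_subset[OF holo]) auto
    then have U: "\<psi> has_fps_expansion U"
      unfolding U_def using R by (intro has_fps_expansion_fps_expansion[of "ball 0 R"]) auto
    have Up: "(\<lambda>z. \<psi> z ^ p) has_fps_expansion U ^ p" for p
      using U by (rule has_fps_expansion_power)
    have U0: "fps_nth U 0 = 0"
      using fps_nth_fps_expansion[OF U, of 0] \<psi>0 by simp
    have holop: "(\<lambda>z. \<psi> z ^ p) holomorphic_on cball 0 R" for p
      using holo by (intro holomorphic_intros)
    have bdp: "norm (\<psi> z ^ p) \<le> M ^ p" if "norm z \<le> R" for z p
      using bd that by (auto simp: norm_power intro!: power_mono)
    define E where "E x = exp (- ((of_real x)\<^sup>2 / 2) * \<psi> (\<i> * of_real (\<epsilon> * x)))" for x :: real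
    define Q where "Q x = (\<Sum>p<P. \<Sum>j<P. (- 1 / 2) ^ p / fact p * fps_nth (U ^ p) j * \<i> ^ j * of_real \<epsilon> ^ j *
        of_real (x ^ (2 * p + j)))" for x :: real
    define S where "S = {-\<eta>/\<epsilon>..\<eta>/\<epsilon>}"
    have pointwise: "norm (indicator S x *\<^sub>R E x - Q x) \<le> C1 * \<epsilon> ^ P * ((1 + \<bar>x\<bar>) ^ (4 * P) * exp (x\<^sup>2 / 4))" for x
    proof -
      define z where "z = \<i> * of_real (\<epsilon> * x)"
      define X where "X = 1 + \<bar>x\<bar>"
      define c where "c p = (- (complex_of_real x)\<^sup>2 / 2) ^ p / fact p" for p
      have X: "X \<ge> 1" "\<bar>x\<bar> \<le> X" by (auto simp: X_def)
      have norm_z: "norm z = \<epsilon> * \<bar>x\<bar>" using \<epsilon> by (simp add: z_def norm_mult)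
      have Xpow: "\<bar>x\<bar> ^ i \<le> X ^ i'" if "i \<le> i'" for i i'
        using power_mono[OF X(2), of i] power_increasing[OF that X(1)] by simp
      have norm_c: "norm (c p) \<le> \<bar>x\<bar> ^ (2 * p)" for p
      proof -
        have "norm (c p) = (\<bar>x\<bar> ^ 2 / 2) ^ p / fact p"
          by (simp add: c_def norm_divide norm_power)
        also have "\<dots> \<le> (\<bar>x\<bar> ^ 2) ^ p / 1"
          by (intro frac_le power_mono) auto
        finally show ?thesis by (simp add: power_mult)
      qed
      have Q: "Q x = (\<Sum>p<P. c p * (\<Sum>j<P. fps_nth (U ^ p) j * z ^ j))"
        unfolding Q_def c_def z_def sum_distrib_left
        by (intro sum.cong refl)
           (simp add: power_mult_distrib power_add power_mult power_divide power_minus[of "_ / 2"] power_minus[of "(_)\<^sup>2"] mult_ac,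
             metis mult.commute power_mult)
      have exp1: "exp (x\<^sup>2 / 4) \<ge> 1" by simp
      have nonneg: "0 \<le> (M / R) ^ P" "0 \<le> (\<Sum>p<P. 2 * M ^ p / R ^ P)" "0 \<le> (\<Sum>p<P. \<Sum>j<P. M ^ p / R ^ j / \<eta> ^ P)"
        using M R \<eta> by (auto intro!: sum_nonneg)
      show ?thesis
      proof (cases "x \<in> S")
        case True
        then have z: "norm z \<le> \<eta>"
          using \<epsilon> by (auto simp: norm_z S_def field_simps abs_le_iff)
        then have zR: "norm z \<le> R / 2" "norm z \<le> R"
          using \<eta> R by auto
        define t where "t = - ((of_real x)\<^sup>2 / 2) * \<psi> z"
        have norm_\<psi>: "norm (\<psi> z) \<le> 2 * M * (\<epsilon> * \<bar>x\<bar> / R)"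
          using norm_taylor_remainder_le[OF holo R _ U zR(1), of M 1] bd U0 by (simp add: norm_z)
        have norm_t: "norm t \<le> x\<^sup>2 / 4"
          using half z mult_left_mono[of "norm (\<psi> z)" "1/2" "x\<^sup>2 / 2"]
          by (simp add: t_def norm_mult norm_divide norm_power)
        have norm_t': "norm t \<le> M / R * \<epsilon> * \<bar>x\<bar> ^ 3"
          using mult_left_mono[OF norm_\<psi>, of "x\<^sup>2 / 2"]
          by (simp add: t_def norm_mult norm_divide norm_power power2_eq_square power3_eq_cube abs_mult mult_ac)
        have "norm (exp t - (\<Sum>p\<le>P-1. t ^ p / fact p)) \<le> exp (norm t) * norm t ^ Suc (P - 1) / fact (P - 1)"
          by (rule Taylor_exp_field)
        also have "\<dots> \<le> exp (x\<^sup>2 / 4) * (M / R * \<epsilon> * \<bar>x\<bar> ^ 3) ^ P / 1"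
        proof (intro frac_le mult_mono)
          show "norm t ^ Suc (P - 1) \<le> (M / R * \<epsilon> * \<bar>x\<bar> ^ 3) ^ P"
            using P power_mono[OF norm_t' norm_ge_zero, of P] by simp
        qed (use norm_t M R \<epsilon> in auto)
        also have "\<dots> = (M / R) ^ P * \<epsilon> ^ P * (\<bar>x\<bar> ^ (3 * P) * exp (x\<^sup>2 / 4))"
          by (simp add: power_mult_distrib power_mult power_divide)
        also have "\<dots> \<le> (M / R) ^ P * \<epsilon> ^ P * (X ^ (4 * P) * exp (x\<^sup>2 / 4))"
          using nonneg \<epsilon> by (intro mult_left_mono mult_right_mono Xpow) auto
        also have "{..P-1} = {..<P}" using P by auto
        finally have R1: "norm (E x - (\<Sum>p<P. t ^ p / fact p)) \<le> (M / R) ^ P * \<epsilon> ^ P * (X ^ (4 * P) * exp (x\<^sup>2 / 4))"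
          by (simp add: E_def t_def z_def)
        have "t ^ p / fact p = c p * \<psi> z ^ p" for p
          unfolding t_def c_def power_mult_distrib by simp
        then have "norm ((\<Sum>p<P. t ^ p / fact p) - Q x) = norm (\<Sum>p<P. c p * (\<psi> z ^ p - (\<Sum>j<P. fps_nth (U ^ p) j * z ^ j)))"
          by (simp add: Q sum_subtractf algebra_simps)
        also have "\<dots> \<le> (\<Sum>p<P. 2 * M ^ p / R ^ P * (\<epsilon> ^ P * (X ^ (4 * P) * exp (x\<^sup>2 / 4))))"
        proof (rule sum_norm_le)
          fix p assume "p \<in> {..<P}"
          then have p: "p < P" by simp
          have "norm (c p * (\<psi> z ^ p - (\<Sum>j<P. fps_nth (U ^ p) j * z ^ j))) \<le> \<bar>x\<bar> ^ (2 * p) * (2 * M ^ p * (norm z / R) ^ P)"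
            unfolding norm_mult
            by (intro mult_mono norm_c norm_taylor_remainder_le[OF holop R bdp Up zR(1)]) auto
          also have "\<dots> = 2 * M ^ p / R ^ P * (\<epsilon> ^ P * (\<bar>x\<bar> ^ (2 * p + P) * 1))"
            by (simp add: norm_z power_mult_distrib power_divide power_add)
          also have "\<dots> \<le> 2 * M ^ p / R ^ P * (\<epsilon> ^ P * (X ^ (4 * P) * exp (x\<^sup>2 / 4)))"
            using M R \<epsilon> p X exp1 by (intro mult_left_mono mult_mono Xpow) auto
          finally show "norm (c p * (\<psi> z ^ p - (\<Sum>j<P. fps_nth (U ^ p) j * z ^ j))) \<le> 2 * M ^ p / R ^ P * (\<epsilon> ^ P * (X ^ (4 * P) * exp (x\<^sup>2 / 4)))" .
        qed
        finally have R2: "norm ((\<Sum>p<P. t ^ p / fact p) - Q x) \<le> (\<Sum>p<P. 2 * M ^ p / R ^ P) * (\<epsilon> ^ P * (X ^ (4 * P) * exp (x\<^sup>2 / 4)))"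
          by (simp only: sum_distrib_right)
        have "norm (indicator S x *\<^sub>R E x - Q x) \<le> norm (E x - (\<Sum>p<P. t ^ p / fact p)) + norm ((\<Sum>p<P. t ^ p / fact p) - Q x)"
          using True norm_triangle_ineq[of "E x - (\<Sum>p<P. t ^ p / fact p)" "(\<Sum>p<P. t ^ p / fact p) - Q x"] by simp
        also have "\<dots> \<le> ((M / R) ^ P + (\<Sum>p<P. 2 * M ^ p / R ^ P)) * (\<epsilon> ^ P * (X ^ (4 * P) * exp (x\<^sup>2 / 4)))"
          using R1 R2 by (simp only: distrib_right mult.assoc)
        also have "\<dots> \<le> C1 * (\<epsilon> ^ P * (X ^ (4 * P) * exp (x\<^sup>2 / 4)))"
          using nonneg X \<epsilon> by (intro mult_right_mono) (auto simp: C1_def)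
        finally show ?thesis by (simp only: X_def mult.assoc)
      next
        case False
        then have "\<eta> / \<epsilon> \<le> \<bar>x\<bar>"
          by (auto simp: S_def)
        then have "1 \<le> \<epsilon> * \<bar>x\<bar> / \<eta>"
          using \<epsilon> \<eta> by (simp add: field_simps)
        then have big: "1 \<le> (\<epsilon> * \<bar>x\<bar> / \<eta>) ^ P" by simp
        have "norm (indicator S x *\<^sub>R E x - Q x) = norm (\<Sum>p<P. \<Sum>j<P. c p * (fps_nth (U ^ p) j * z ^ j))"
          using False by (simp add: Q sum_distrib_left)
        also have "\<dots> \<le> (\<Sum>p<P. \<Sum>j<P. M ^ p / R ^ j / \<eta> ^ P * (\<epsilon> ^ P * (X ^ (4 * P) * exp (x\<^sup>2 / 4))))"
        proof (intro sum_norm_le)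
          fix p j assume "p \<in> {..<P}" "j \<in> {..<P}"
          then have pj: "2 * p + j + P \<le> 4 * P" by simp
          have "norm (c p * (fps_nth (U ^ p) j * z ^ j)) \<le> \<bar>x\<bar> ^ (2 * p) * (M ^ p / R ^ j * (1 * \<bar>x\<bar>) ^ j)"
            unfolding norm_mult norm_power norm_z using M R \<epsilon>
            by (intro mult_mono norm_c norm_taylor_coeff_le[OF holop R bdp Up] power_mono) auto
          also have "\<dots> = \<bar>x\<bar> ^ (2 * p) * (M ^ p / R ^ j * \<bar>x\<bar> ^ j) * 1"
            by simp
          also have "\<dots> \<le> \<bar>x\<bar> ^ (2 * p) * (M ^ p / R ^ j * \<bar>x\<bar> ^ j) * (\<epsilon> * \<bar>x\<bar> / \<eta>) ^ P"
            using big M R by (intro mult_left_mono) auto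
          also have "\<dots> = M ^ p / R ^ j / \<eta> ^ P * (\<epsilon> ^ P * (\<bar>x\<bar> ^ (2 * p + j + P) * 1))"
            by (simp add: power_mult_distrib power_divide power_add)
          also have "\<dots> \<le> M ^ p / R ^ j / \<eta> ^ P * (\<epsilon> ^ P * (X ^ (4 * P) * exp (x\<^sup>2 / 4)))"
            using M R \<eta> \<epsilon> X exp1 pj by (intro mult_left_mono mult_mono Xpow) auto
          finally show "norm (c p * (fps_nth (U ^ p) j * z ^ j)) \<le> M ^ p / R ^ j / \<eta> ^ P * (\<epsilon> ^ P * (X ^ (4 * P) * exp (x\<^sup>2 / 4)))" .
        qed
        also have "\<dots> = (\<Sum>p<P. \<Sum>j<P. M ^ p / R ^ j / \<eta> ^ P) * (\<epsilon> ^ P * (X ^ (4 * P) * exp (x\<^sup>2 / 4)))"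
          by (simp only: sum_distrib_right)
        also have "\<dots> \<le> C1 * (\<epsilon> ^ P * (X ^ (4 * P) * exp (x\<^sup>2 / 4)))"
          using nonneg X \<epsilon> by (intro mult_right_mono) (auto simp: C1_def)
        finally show ?thesis by (simp only: X_def mult.assoc)
      qed
    qed
    have Q_int: "has_bochner_integral lborel (\<lambda>x. std_normal_density x *\<^sub>R Q x)
        (\<Sum>p<P. \<Sum>j<P. (- 1 / 2) ^ p / fact p * fps_nth (U ^ p) j * \<i> ^ j * of_real \<epsilon> ^ j *
           of_real (gaussian_moment (2 * p + j)))"
    proof -
      have *: "has_bochner_integral lborel (\<lambda>x. complex_of_real (std_normal_density x * x ^ n)) (of_real (gaussian_moment n))" for n
        by (rule has_bochner_integral_of_real[OF has_bochner_integral_gaussian_moment])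
      have "has_bochner_integral lborel (\<lambda>x. \<Sum>p<P. \<Sum>j<P. (- 1 / 2) ^ p / fact p * fps_nth (U ^ p) j * \<i> ^ j * of_real \<epsilon> ^ j *
           of_real (std_normal_density x * x ^ (2 * p + j)))
        (\<Sum>p<P. \<Sum>j<P. (- 1 / 2) ^ p / fact p * fps_nth (U ^ p) j * \<i> ^ j * of_real \<epsilon> ^ j *
           of_real (gaussian_moment (2 * p + j)))"
        by (intro has_bochner_integral_sum has_bochner_integral_mult_right *)
      then show ?thesis
        by (simp add: Q_def scaleR_conv_of_real sum_distrib_left mult_ac)
    qed
    have Q_eq: "(\<Sum>p<P. \<Sum>j<P. (- 1 / 2) ^ p / fact p * fps_nth (U ^ p) j * \<i> ^ j * of_real \<epsilon> ^ j *
           of_real (gaussian_moment (2 * p + j))) = (\<Sum>\<nu>\<le>N. saddle_coeff \<psi> \<nu> * of_real \<epsilon> ^ (2 * \<nu>))"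
    proof -
      have "(\<Sum>p<P. \<Sum>j<P. (- 1 / 2) ^ p / fact p * fps_nth (U ^ p) j * \<i> ^ j * of_real \<epsilon> ^ j *
           of_real (gaussian_moment (2 * p + j))) =
         (\<Sum>j<P. (\<Sum>p<P. (- 1 / 2) ^ p / fact p * fps_nth (U ^ p) j * \<i> ^ j *
           of_real (gaussian_moment (2 * p + j))) * of_real \<epsilon> ^ j)"
        by (subst sum.swap) (simp add: sum_distrib_left sum_distrib_right mult_ac)
      also have "\<dots> = (\<Sum>\<nu>\<le>N. (\<Sum>p<P. (- 1 / 2) ^ p / fact p * fps_nth (U ^ p) (2 * \<nu>) * \<i> ^ (2 * \<nu>) *
           of_real (gaussian_moment (2 * p + 2 * \<nu>))) * of_real \<epsilon> ^ (2 * \<nu>))"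
        unfolding P_def by (rule sum_lessThan_even) (simp add: gaussian_moment_def)
      also have "\<dots> = (\<Sum>\<nu>\<le>N. saddle_coeff \<psi> \<nu> * of_real \<epsilon> ^ (2 * \<nu>))"
        by (intro sum.cong refl arg_cong2[where f = "(*)"] saddle_coeff_eq_moments[OF U U0])
           (auto simp: P_def)
      finally show ?thesis .
    qed
    have S_sub: "norm (\<i> * of_real (\<epsilon> * x)) \<le> \<eta>" if "x \<in> S" for x
      using that \<epsilon> by (auto simp: S_def norm_mult abs_mult field_simps abs_le_iff)
    have contE: "continuous_on S E"
      unfolding E_def
      by (intro continuous_intros continuous_on_compose2[OF holomorphic_on_imp_continuous_on[OF holo]])
         (use S_sub \<eta> R in \<open>force+\<close>)
    have E_int: "set_integrable lborel S (\<lambda>x. std_normal_density x *\<^sub>R E x)"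
      unfolding S_def
      by (rule borel_integrable_atLeastAtMost') (use contE in \<open>auto simp: S_def std_normal_density_def intro!: continuous_intros\<close>)
    have diff_int: "integrable lborel (\<lambda>x. indicator S x *\<^sub>R (std_normal_density x *\<^sub>R E x) - std_normal_density x *\<^sub>R Q x)"
      using E_int Q_int unfolding set_integrable_def
      by (intro Bochner_Integration.integrable_diff) (auto intro: integrable.intros)
    have "(LINT x:S|lborel. std_normal_density x *\<^sub>R E x) - (\<Sum>\<nu>\<le>N. saddle_coeff \<psi> \<nu> * of_real \<epsilon> ^ (2 * \<nu>)) =
          (LINT x|lborel. indicator S x *\<^sub>R (std_normal_density x *\<^sub>R E x) - std_normal_density x *\<^sub>R Q x)"
      unfolding Q_eq[symmetric] has_bochner_integral_integral_eq[OF Q_int, symmetric] set_lebesgue_integral_def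
      using E_int Q_int unfolding set_integrable_def
      by (intro Bochner_Integration.integral_diff[symmetric]) (auto intro: integrable.intros)
    also have "norm \<dots> \<le> (LINT x|lborel. C1 * \<epsilon> ^ P * wt x)"
    proof (rule Bochner_Integration.integral_norm_bound_integral[OF diff_int])
      show "integrable lborel (\<lambda>x. C1 * \<epsilon> ^ P * wt x)"
        using wt by simp
      show "norm (indicator S x *\<^sub>R (std_normal_density x *\<^sub>R E x) - std_normal_density x *\<^sub>R Q x) \<le> C1 * \<epsilon> ^ P * wt x" for x
      proof -
        have "indicator S x *\<^sub>R (std_normal_density x *\<^sub>R E x) - std_normal_density x *\<^sub>R Q x =
              std_normal_density x *\<^sub>R (indicator S x *\<^sub>R E x - Q x)"
          by (simp add: algebra_simps)
        also have "norm \<dots> \<le> std_normal_density x * (C1 * \<epsilon> ^ P * ((1 + \<bar>x\<bar>) ^ (4 * P) * exp (x\<^sup>2 / 4)))"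
          by (simp add: mult_left_mono pointwise)
        finally show ?thesis by (simp add: wt_def mult_ac)
      qed
    qed
    finally show "norm ((LINT x:{-\<eta>/\<epsilon>..\<eta>/\<epsilon>}|lborel. std_normal_density x *\<^sub>R exp (- ((of_real x)\<^sup>2 / 2) * \<psi> (\<i> * of_real (\<epsilon> * x))))
        - (\<Sum>\<nu>\<le>N. saddle_coeff \<psi> \<nu> * of_real \<epsilon> ^ (2 * \<nu>))) \<le> (C1 * (LINT x|lborel. wt x)) * \<epsilon> ^ (2 * N + 2)"
      by (simp add: E_def S_def P_def mult_ac)
  qed
qed

section \<open>Complexification and the logarithm of a power series\<close>

lemma complex_fps_nth [simp]: "fps_nth (complex_fps g) k = of_real (fps_nth g k)"
  by (simp add: complex_fps_def)

lemma complex_fps_1 [simp]: "complex_fps 1 = 1"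
  by (simp add: fps_eq_iff fps_one_def)

lemma complex_fps_mult: "complex_fps (g * h) = complex_fps g * complex_fps h"
  by (simp add: fps_eq_iff fps_mult_nth)

lemma complex_fps_power: "complex_fps (g ^ n) = complex_fps g ^ n"
  by (induction n) (simp_all add: complex_fps_mult)

lemma complex_fps_deriv: "complex_fps (fps_deriv g) = fps_deriv (complex_fps g)"
  by (simp add: fps_eq_iff)

lemma complex_fps_XD: "complex_fps (fps_XD g) = fps_XD (complex_fps g)"
  by (simp add: fps_eq_iff)

lemma fps_conv_radius_complex_fps [simp]: "fps_conv_radius (complex_fps g) = fps_conv_radius g"
proof -
  have "conv_radius (\<lambda>k. complex_of_real (fps_nth g k)) = conv_radius (\<lambda>k. norm (complex_of_real (fps_nth g k)))"
    by (simp only: conv_radius_norm)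
  also have "\<dots> = conv_radius (\<lambda>k. norm (fps_nth g k))" by simp
  also have "\<dots> = conv_radius (fps_nth g)" by (simp only: conv_radius_norm)
  finally show ?thesis by (simp add: fps_conv_radius_def)
qed

lemma eval_complex_fps_of_real:
  assumes "ereal \<bar>x\<bar> < fps_conv_radius g"
  shows "eval_fps (complex_fps g) (of_real x) = of_real (eval_fps g x)"
proof -
  have "(\<lambda>k. of_real (fps_nth g k * x ^ k)) sums complex_of_real (eval_fps g x)"
    by (rule sums_of_real[OF sums_eval_fps]) (use assms in simp)
  then show ?thesis
    unfolding eval_fps_def by (simp add: sums_iff)
qed

lemma fps_conv_radius_XD: "fps_conv_radius (fps_XD g) \<ge> fps_conv_radius (g :: 'a :: {banach, real_normed_field} fps)"
proof -
  have "fps_conv_radius g \<le> fps_conv_radius (fps_deriv g)" by (rule fps_conv_radius_deriv)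
  also have "\<dots> \<le> fps_conv_radius (fps_X * fps_deriv g)"
    using fps_conv_radius_mult[of fps_X "fps_deriv g"] by simp
  finally show ?thesis by (simp add: fps_XD_def)
qed

lemma eval_fps_XD:
  fixes g :: "'a :: {banach, real_normed_field} fps"
  assumes "ereal (norm z) < fps_conv_radius g"
  shows "eval_fps (fps_XD g) z = z * eval_fps (fps_deriv g) z"
  using assms fps_conv_radius_deriv[of g]
  by (simp add: fps_XD_def eval_fps_mult less_le_trans)

lemma tendsto_eval_fps_leading:
  fixes g :: "'a :: {banach, real_normed_field} fps"
  assumes rad: "fps_conv_radius g > 0" and zero: "\<And>k. k < l \<Longrightarrow> fps_nth g k = 0"
  shows "((\<lambda>z. eval_fps g z / z ^ l) \<longlongrightarrow> fps_nth g l) (at 0)"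
proof (cases "g = 0")
  case False
  then have l: "l \<le> subdegree g" using zero by (intro subdegree_geI) auto
  have "isCont (eval_fps (fps_shift l g)) 0"
    using rad by (intro continuous_eval_fps) (auto simp: zero_ereal_def)
  then have "(eval_fps (fps_shift l g) \<longlongrightarrow> fps_nth g l) (at 0)"
    by (simp add: isCont_def eval_fps_at_0)
  moreover have "\<forall>\<^sub>F z in at 0. z \<in> eball 0 (fps_conv_radius g) - {0}"
    using rad by (intro eventually_at_in_open) (auto simp: zero_ereal_def)
  then have "\<forall>\<^sub>F z in at 0. eval_fps (fps_shift l g) z = eval_fps g z / z ^ l"
    by eventually_elim (use l in \<open>auto simp: eval_fps_shift\<close>)
  ultimately show ?thesis by (rule Lim_transform_eventually)
qed auto

definition log_fps :: "real fps \<Rightarrow> real fps" where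
  "log_fps f = fps_integral0 (fps_deriv f * inverse f)"

lemma log_fps_0 [simp]: "fps_nth (log_fps f) 0 = 0"
  by (simp add: log_fps_def)

lemma fps_deriv_log_fps: "fps_nth f 0 \<noteq> 0 \<Longrightarrow> fps_deriv (log_fps f) * f = fps_deriv f"
  by (simp add: log_fps_def fps_deriv_fps_integral mult.assoc inverse_mult_eq_1)

text \<open>
  Integration divides the coefficients by their index, so the series
  converges wherever \<open>z f'(z) / f(z)\<close> does.
\<close>

lemma fps_conv_radius_log_fps_pos:
  assumes "fps_nth f 0 \<noteq> 0" "fps_conv_radius f > 0"
  shows "fps_conv_radius (log_fps f) > 0"
proof -
  define g where "g = fps_deriv f * inverse f"
  have "0 < min (fps_conv_radius (fps_deriv f)) (fps_conv_radius (inverse f))"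
    using assms fps_conv_radius_deriv[of f] fps_conv_radius_inverse_pos[OF assms] by (simp add: less_le_trans)
  also have "\<dots> \<le> fps_conv_radius g"
    unfolding g_def by (rule fps_conv_radius_mult)
  also have "\<dots> \<le> fps_conv_radius (fps_X * g)"
    using fps_conv_radius_mult[of fps_X g] by simp
  also have "\<dots> \<le> fps_conv_radius (log_fps f)"
    unfolding fps_conv_radius_def
  proof (rule conv_radius_geI_ex')
    fix r :: real assume r: "0 < r" "ereal r < conv_radius (fps_nth (fps_X * g))"
    then have "summable (\<lambda>n. norm (fps_nth (fps_X * g) n * r ^ n))"
      by (intro abs_summable_in_conv_radius) auto
    then show "summable (\<lambda>n. fps_nth (log_fps f) n * of_real r ^ n)"
    proof (rule summable_comparison_test')
      fix n
      show "norm (fps_nth (log_fps f) n * of_real r ^ n) \<le> norm (fps_nth (fps_X * g) n * r ^ n)"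
        using r by (cases n) (auto simp: log_fps_def g_def[symmetric] fps_integral_def abs_mult inverse_le_1_iff
            intro!: mult_right_mono mult_left_le_one_le)
    qed
  qed
  finally show ?thesis .
qed

text \<open>
  Comparison of coefficients in \<open>z h'(z) f(z) = z f'(z)\<close>.
\<close>

lemma log_fps_recurrence:
  assumes "fps_nth f 0 \<noteq> 0"
  shows "real k * fps_nth f k = (\<Sum>i=0..k. real i * fps_nth (log_fps f) i * fps_nth f (k - i))"
proof -
  have "fps_XD (log_fps f) * f = fps_XD f"
    using fps_deriv_log_fps[OF assms] by (simp add: fps_XD_def mult.assoc)
  then have "fps_nth (fps_XD f) k = fps_nth (fps_XD (log_fps f) * f) k" by simp
  then show ?thesis by (simp add: fps_mult_nth)
qed

text \<open>
  In the recurrence for \<open>k b\<^sub>k\<close> every product \<open>b\<^sub>i a\<^bsub>k-i\<^esub>\<close> with \<open>0 < i < k\<close> vanishes: as \<open>k\<close> lies outside the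
  additively closed set \<open>D\<close>, so is \<open>i\<close> or \<open>k - i\<close>. This is applied to the multiples of \<open>l / gcd(l, j)\<close>
  and, to find the leading term of \<open>h\<close>, to \<open>D = {0}\<close>.
\<close>

lemma log_fps_nth_outside_subgroup:
  assumes f0: "fps_nth f 0 = 1"
    and closed: "\<And>i j. D i \<Longrightarrow> D j \<Longrightarrow> D (i + j)"
    and zero: "\<And>k. 0 < k \<Longrightarrow> k < L \<Longrightarrow> \<not> D k \<Longrightarrow> fps_nth f k = 0"
    and k: "0 < k" "k \<le> L" "\<not> D k"
  shows "fps_nth (log_fps f) k = fps_nth f k"
  using k
proof (induction k rule: less_induct)
  case (less k)
  have "real i * fps_nth (log_fps f) i * fps_nth f (k - i) = 0" if i: "i < k" for i
  proof (cases "i = 0 \<or> D i")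
    case True
    moreover have "0 < i \<Longrightarrow> k - i < L" using less.prems i by linarith
    ultimately show ?thesis
      using closed[of i "k - i"] zero[of "k - i"] less.prems i by (cases "i = 0") auto
  next
    case False
    then have "fps_nth (log_fps f) i = fps_nth f i" "fps_nth f i = 0"
      using less.IH[of i] zero[of i] less.prems i by auto
    then show ?thesis by simp
  qed
  then have "(\<Sum>i=0..<k. real i * fps_nth (log_fps f) i * fps_nth f (k - i)) = 0"
    by (intro sum.neutral) auto
  moreover have "{0..k} = insert k {0..<k}" by auto
  ultimately have "real k * fps_nth f k = real k * fps_nth (log_fps f) k"
    using log_fps_recurrence[of f k] f0 by simp
  then show ?case using less.prems by simp
qed

text \<open>
  The function \<open>exp (- h) f\<close> has derivative zero and equals \<open>1\<close> at the origin.
\<close>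

lemma exp_eval_log_fps:
  assumes f0: "fps_nth f 0 = 1"
    and z: "ereal (norm z) < fps_conv_radius f" "ereal (norm z) < fps_conv_radius (log_fps f)"
  shows "exp (eval_fps (complex_fps (log_fps f)) z) = eval_fps (complex_fps f) z"
proof -
  define F H where "F = complex_fps f" and "H = complex_fps (log_fps f)"
  have HF: "fps_deriv H * F = fps_deriv F"
    using fps_deriv_log_fps[of f] f0
    by (simp add: F_def H_def complex_fps_deriv[symmetric] complex_fps_mult[symmetric])
  have rad: "ereal (norm w) < fps_conv_radius F \<and> ereal (norm w) < fps_conv_radius H" if "w \<in> cball 0 (norm z)" for w
    using that z by (auto simp: F_def H_def intro: le_less_trans[of _ "ereal (norm z)"])
  have "((\<lambda>w. exp (- eval_fps H w) * eval_fps F w) has_field_derivative 0) (at w within cball 0 (norm z))"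
    if w: "w \<in> cball 0 (norm z)" for w
  proof -
    have "((\<lambda>w. exp (- eval_fps H w) * eval_fps F w) has_field_derivative
       (exp (- eval_fps H w) * eval_fps (fps_deriv F) w + exp (- eval_fps H w) * (- eval_fps (fps_deriv H) w) * eval_fps F w)) (at w within cball 0 (norm z))"
      using rad[OF w] by (auto intro!: derivative_eq_intros has_field_derivative_eval_fps)
    moreover have "eval_fps (fps_deriv F) w = eval_fps (fps_deriv H) w * eval_fps F w"
      using rad[OF w] fps_conv_radius_deriv[of H]
      by (subst HF[symmetric], subst eval_fps_mult) (auto intro: less_le_trans)
    ultimately show ?thesis by (simp add: algebra_simps)
  qed
  then obtain c where c: "\<And>w. w \<in> cball 0 (norm z) \<Longrightarrow> exp (- eval_fps H w) * eval_fps F w = c"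
    using has_field_derivative_zero_constant[of "cball 0 (norm z)" "\<lambda>w. exp (- eval_fps H w) * eval_fps F w"] by auto
  from c[of 0] have "c = 1"
    using f0 by (simp add: eval_fps_at_0 F_def H_def)
  with c[of z] show ?thesis by (simp add: F_def H_def exp_minus field_simps)
qed

lemma exp_eval_log_fps_real:
  assumes f0: "fps_nth f 0 = 1"
    and x: "ereal \<bar>x\<bar> < fps_conv_radius f" "ereal \<bar>x\<bar> < fps_conv_radius (log_fps f)"
  shows "exp (eval_fps (log_fps f) x) = eval_fps f x"
proof -
  have "complex_of_real (exp (eval_fps (log_fps f) x)) = of_real (eval_fps f x)"
    using exp_eval_log_fps[OF f0, of "of_real x"] x by (simp add: eval_complex_fps_of_real exp_of_real[symmetric])
  then show ?thesis by (simp only: of_real_eq_iff)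
qed

lemma mu_f_eq:
  assumes f0: "fps_nth f 0 = 1"
    and x: "ereal \<bar>x\<bar> < fps_conv_radius f" "ereal \<bar>x\<bar> < fps_conv_radius (log_fps f)"
  shows "mu_f f x = eval_fps (fps_XD (log_fps f)) x"
proof -
  have f': "deriv (eval_fps f) x = eval_fps (fps_deriv f) x"
    using has_field_derivative_eval_fps[of x f] x by (intro DERIV_imp_deriv) auto
  also have "\<dots> = eval_fps (fps_deriv (log_fps f)) x * eval_fps f x"
    using x fps_conv_radius_deriv[of "log_fps f"] f0
    by (subst fps_deriv_log_fps[symmetric], simp, subst eval_fps_mult) (auto intro: less_le_trans)
  finally show ?thesis
    using x exp_eval_log_fps_real[OF assms, symmetric] by (simp add: mu_f_def eval_fps_XD)
qed

lemma sigma_f_eq: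
  assumes f0: "fps_nth f 0 = 1"
    and x: "ereal \<bar>x\<bar> < fps_conv_radius f" "ereal \<bar>x\<bar> < fps_conv_radius (log_fps f)"
  shows "sigma_f f x = eval_fps (fps_XD (fps_XD (log_fps f))) x"
proof -
  have "open (eball 0 (min (fps_conv_radius f) (fps_conv_radius (log_fps f))) :: real set)" by simp
  then have "\<forall>\<^sub>F y in nhds x. y \<in> eball 0 (min (fps_conv_radius f) (fps_conv_radius (log_fps f)))"
    using x by (intro eventually_nhds_in_open) auto
  then have "\<forall>\<^sub>F y in nhds x. mu_f f y = eval_fps (fps_XD (log_fps f)) y"
    by eventually_elim (auto intro: mu_f_eq[OF f0])
  then have "deriv (mu_f f) x = deriv (eval_fps (fps_XD (log_fps f))) x"
    by (rule deriv_cong_ev) simp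
  also have "\<dots> = eval_fps (fps_deriv (fps_XD (log_fps f))) x"
    using has_field_derivative_eval_fps[of x "fps_XD (log_fps f)"] x fps_conv_radius_XD[of "log_fps f"]
    by (intro DERIV_imp_deriv) (auto intro: less_le_trans)
  finally show ?thesis
    using x fps_conv_radius_XD[of "log_fps f"] by (simp add: sigma_f_def eval_fps_XD less_le_trans)
qed

section \<open>Cosine sums away from the saddle point\<close>

text \<open>
  Shrinking the radius from \<open>\<rho>\<close> to \<open>r\<close> gains a factor \<open>r / \<rho>\<close> for each power of
  the variable. The tails beyond a leading term are thus of higher order in \<open>r\<close>.
\<close>

lemma power_series_tail_bound:
  fixes w :: "nat \<Rightarrow> real"
  assumes sum: "summable (\<lambda>k. w k * \<rho> ^ k)" and w: "\<And>k. w k \<ge> 0" and r: "0 \<le> r" "r \<le> \<rho>" "0 < \<rho>"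
  obtains T where "(\<lambda>k. if k > K then w k * r ^ k else 0) sums T"
    "0 \<le> T" "T \<le> (r / \<rho>) ^ Suc K * (\<Sum>k. w k * \<rho> ^ k)"
proof -
  have le: "(if k > K then w k * r ^ k else 0) \<le> (r / \<rho>) ^ Suc K * (w k * \<rho> ^ k)" for k
  proof (cases "k > K")
    case True
    then have "k = Suc K + (k - Suc K)" by simp
    then have "r ^ k = r ^ Suc K * r ^ (k - Suc K)"
      by (metis power_add)
    also have "\<dots> \<le> r ^ Suc K * \<rho> ^ (k - Suc K)"
      using r by (intro mult_left_mono power_mono) auto
    also have "\<dots> = (r / \<rho>) ^ Suc K * \<rho> ^ k"
      using r True by (simp add: power_divide power_diff del: power_Suc)
    finally show ?thesis
      using True w[of k] mult_left_mono by (fastforce simp: mult_ac)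
  qed (use w r in auto)
  have nn: "0 \<le> (if k > K then w k * r ^ k else 0)" for k
    using w r by auto
  have s: "summable (\<lambda>k. (r / \<rho>) ^ Suc K * (w k * \<rho> ^ k))"
    by (intro summable_mult sum)
  have s': "summable (\<lambda>k. if k > K then w k * r ^ k else 0)"
    by (rule summable_comparison_test'[OF s, of 0]) (use le nn in auto)
  show ?thesis
  proof
    show "(\<lambda>k. if k > K then w k * r ^ k else 0) sums (\<Sum>k. if k > K then w k * r ^ k else 0)"
      using s' by (rule summable_sums)
    show "0 \<le> (\<Sum>k. if k > K then w k * r ^ k else 0)"
      using s' nn by (rule suminf_nonneg)
    have "(\<Sum>k. if k > K then w k * r ^ k else 0) \<le> (\<Sum>k. (r / \<rho>) ^ Suc K * (w k * \<rho> ^ k))"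
      using le s' s by (rule suminf_le)
    then show "(\<Sum>k. if k > K then w k * r ^ k else 0) \<le> (r / \<rho>) ^ Suc K * (\<Sum>k. w k * \<rho> ^ k)"
      by (simp only: suminf_mult[OF sum])
  qed
qed

lemma abs_sin_mult_le: "\<bar>sin (real k * x)\<bar> \<le> real k * \<bar>sin x\<bar>"
proof (induction k)
  case (Suc k)
  have "\<bar>sin (real (Suc k) * x)\<bar> = \<bar>sin (real k * x) * cos x + cos (real k * x) * sin x\<bar>"
    by (simp add: distrib_right sin_add algebra_simps)
  also have "\<dots> \<le> \<bar>sin (real k * x)\<bar> * \<bar>cos x\<bar> + \<bar>cos (real k * x)\<bar> * \<bar>sin x\<bar>"
    by (metis abs_mult abs_triangle_ineq)
  also have "\<dots> \<le> \<bar>sin (real k * x)\<bar> * 1 + 1 * \<bar>sin x\<bar>"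
    by (intro add_mono mult_left_mono mult_right_mono) auto
  also have "\<dots> \<le> real (Suc k) * \<bar>sin x\<bar>"
    using Suc by (simp add: distrib_right)
  finally show ?case .
qed simp

text \<open>
  Together with the half-angle formula this is \<open>\<bar>sin (k x)\<bar> \<le> k \<bar>sin x\<bar>\<close>. It measures all
  terms of the sum below against the single quantity \<open>1 - cos t\<close>.
\<close>

lemma one_minus_cos_mult_le: "1 - cos (real k * t) \<le> (real k)\<^sup>2 * (1 - cos t)"
proof -
  have half: "1 - cos x = 2 * (sin (x / 2))\<^sup>2" for x :: real
    using cos_double_sin[of "x / 2"] by simp
  have "(sin (real k * (t / 2)))\<^sup>2 \<le> (real k * \<bar>sin (t / 2)\<bar>)\<^sup>2"
    using abs_sin_mult_le[of k "t / 2"] by (metis abs_ge_zero power2_abs power_mono)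
  then show ?thesis
    unfolding half by (simp add: power_mult_distrib)
qed

lemma cos_add_2pi_nat: "cos (x + 2 * pi * real j) = cos x"
  using cos_int_2pin[of "int j"] sin_int_2pin[of "int j"] by (simp add: cos_add)

lemma cos_multiple_root_angle_eq_1_iff:
  assumes "l > 0"
  shows "cos (real k * (2 * pi * real j / real l)) = 1 \<longleftrightarrow> l dvd j * k"
proof
  assume "cos (real k * (2 * pi * real j / real l)) = 1"
  then obtain n :: int where "real k * (2 * pi * real j / real l) = real_of_int n * 2 * pi"
    unfolding cos_one_2pi_int by blast
  then have "real (j * k) = real_of_int n * real l"
    using assms by (simp add: field_simps)
  then have "int (j * k) = n * int l"
    by (metis of_int_eq_iff of_int_mult of_int_of_nat_eq)
  then show "l dvd j * k"
    by (metis dvd_triv_right int_dvd_int_iff)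
next
  assume "l dvd j * k"
  then obtain i where i: "j * k = l * i" by auto
  have "real k * (2 * pi * real j / real l) = 0 + 2 * pi * (real (j * k) / real l)"
    by (simp add: field_simps)
  also have "real (j * k) / real l = real i"
    using assms by (simp add: i)
  finally show "cos (real k * (2 * pi * real j / real l)) = 1"
    by (simp only: cos_add_2pi_nat cos_zero)
qed

text \<open>
  If \<open>b\<close> are the coefficients of \<open>h\<close>, this is the real part of \<open>h(r e\<^sup>i\<^sup>\<theta>) - h(r)\<close>.
\<close>

definition arc_sum :: "(nat \<Rightarrow> real) \<Rightarrow> real \<Rightarrow> real \<Rightarrow> real" where
  "arc_sum b r \<theta> = (\<Sum>k. b k * r ^ k * (cos (real k * \<theta>) - 1))"

lemma summable_arc_sum:
  assumes "summable (\<lambda>k. \<bar>b k\<bar> * (1 + (real k)\<^sup>2) * \<rho> ^ k)" "0 \<le> r" "r \<le> \<rho>"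
  shows "summable (\<lambda>k. b k * r ^ k * (cos (real k * \<theta>) - 1))"
proof (rule summable_comparison_test')
  show "summable (\<lambda>k. 2 * (\<bar>b k\<bar> * (1 + (real k)\<^sup>2) * \<rho> ^ k))"
    using assms by (intro summable_mult)
  fix k
  have "norm (b k * r ^ k * (cos (real k * \<theta>) - 1)) = \<bar>b k\<bar> * r ^ k * \<bar>cos (real k * \<theta>) - 1\<bar>"
    using assms by (simp add: abs_mult)
  also have "\<dots> \<le> (\<bar>b k\<bar> * (1 + (real k)\<^sup>2)) * \<rho> ^ k * 2"
    using assms cos_ge_minus_one[of "real k * \<theta>"] cos_le_one[of "real k * \<theta>"]
    by (intro mult_mono power_mono) (auto simp: mult_le_cancel_left1 abs_le_iff simp del: cos_le_one cos_ge_minus_one)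
  finally show "norm (b k * r ^ k * (cos (real k * \<theta>) - 1)) \<le> 2 * (\<bar>b k\<bar> * (1 + (real k)\<^sup>2) * \<rho> ^ k)"
    by simp
qed

lemma arc_sum_le:
  assumes "summable (\<lambda>k. \<bar>b k\<bar> * (1 + (real k)\<^sup>2) * \<rho> ^ k)" "0 \<le> r" "r \<le> \<rho>"
    and "e sums E" and "\<And>k. b k * r ^ k * (cos (real k * \<theta>) - 1) \<le> e k"
  shows "arc_sum b r \<theta> \<le> E"
  unfolding arc_sum_def using assms(4,5) summable_arc_sum[OF assms(1-3)]
  by (intro sums_le[OF _ summable_sums]) auto

lemma arc_term_le:
  fixes r :: real assumes "r \<ge> 0"
  shows "b * r ^ k * (cos x - 1) \<le> 2 * (\<bar>b\<bar> * (1 + (real k)\<^sup>2) * r ^ k)"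
proof -
  have "b * r ^ k * (cos x - 1) \<le> \<bar>b * r ^ k * (cos x - 1)\<bar>" by simp
  also have "\<dots> = (\<bar>b\<bar> * 1) * r ^ k * \<bar>cos x - 1\<bar>"
    using assms by (simp add: abs_mult)
  also have "\<dots> \<le> (\<bar>b\<bar> * (1 + (real k)\<^sup>2)) * r ^ k * 2"
    using assms cos_ge_minus_one[of x] cos_le_one[of x]
    by (intro mult_mono) (auto simp: abs_le_iff simp del: cos_le_one cos_ge_minus_one)
  finally show ?thesis by simp
qed

text \<open>
  At a distance of at least \<open>\<tau>\<close> from the angles \<open>2\<pi>j/l\<close> the term with index \<open>l\<close> dominates.
\<close>

lemma arc_sum_far:
  fixes b :: "nat \<Rightarrow> real"
  assumes sum: "summable (\<lambda>k. \<bar>b k\<bar> * (1 + (real k)\<^sup>2) * \<rho> ^ k)" and \<rho>: "0 < \<rho>"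
    and l: "l > 0" "\<And>k. 0 < k \<Longrightarrow> k < l \<Longrightarrow> b k = 0" "b l > 0" and \<tau>: "0 < \<tau>"
  shows "\<exists>c>0. \<exists>r0>0. \<forall>r j t. 0 < r \<longrightarrow> r < r0 \<longrightarrow> \<tau> \<le> \<bar>t\<bar> \<longrightarrow> \<bar>t\<bar> \<le> pi / l \<longrightarrow>
           arc_sum b r (2 * pi * real j / real l + t) \<le> - c * r ^ l"
proof (cases "\<tau> \<le> pi / l")
  case False
  then show ?thesis by (auto intro!: exI[of _ "1::real"] gt_ex)
next
  case True
  define w where "w k = \<bar>b k\<bar> * (1 + (real k)\<^sup>2)" for k
  define W where "W = (\<Sum>k. w k * \<rho> ^ k)"
  define c where "c = b l * (1 - cos (l * \<tau>))"
  have w0: "w k \<ge> 0" for k by (simp add: w_def)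
  have sumw: "summable (\<lambda>k. w k * \<rho> ^ k)" using sum by (simp add: w_def)
  have W: "W \<ge> 0"
    unfolding W_def by (rule suminf_nonneg[OF sumw]) (use w0 \<rho> in auto)
  have l\<tau>: "0 < l * \<tau>" "l * \<tau> \<le> pi" using True l \<tau> by (auto simp: field_simps)
  have "cos (l * \<tau>) < cos 0" by (rule cos_monotone_0_pi) (use l\<tau> in auto)
  then have c: "c > 0" using l by (simp add: c_def)
  define r0 where "r0 = min \<rho> (c * \<rho> ^ Suc l / (4 * W + 1))"
  have r0: "r0 > 0" using \<rho> c W by (simp add: r0_def)
  have "arc_sum b r (2 * pi * real j / real l + t) \<le> - (c / 2) * r ^ l"
    if r: "0 < r" "r < r0" and t: "\<tau> \<le> \<bar>t\<bar>" "\<bar>t\<bar> \<le> pi / l" for r j t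
  proof -
    have r': "0 \<le> r" "r \<le> \<rho>" using r by (auto simp: r0_def)
    obtain T where T: "(\<lambda>k. if k > l then w k * r ^ k else 0) sums T" "0 \<le> T" "T \<le> (r / \<rho>) ^ Suc l * W"
      unfolding W_def by (rule power_series_tail_bound[OF sumw w0 r' \<rho>])
    have cos_l: "cos (real l * (2 * pi * real j / real l + t)) \<le> cos (l * \<tau>)"
    proof -
      have "real l * (2 * pi * real j / real l + t) = l * t + 2 * pi * real j"
        using l by (simp add: field_simps)
      then have "cos (real l * (2 * pi * real j / real l + t)) = cos (l * t)"
        by (simp only: cos_add_2pi_nat)
      also have "\<dots> = cos (l * \<bar>t\<bar>)"
        by (metis abs_if abs_of_nat abs_mult cos_abs_real)
      also have "\<dots> \<le> cos (l * \<tau>)"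
        using t l\<tau> l by (intro cos_monotone_0_pi_le mult_left_mono) (auto simp: field_simps)
      finally show ?thesis .
    qed
    have "arc_sum b r (2 * pi * real j / real l + t) \<le> - (c * r ^ l) + 2 * T"
    proof (rule arc_sum_le[OF sum r'])
      show "(\<lambda>k. (if k = l then - (c * r ^ l) else 0) + 2 * (if k > l then w k * r ^ k else 0)) sums (- (c * r ^ l) + 2 * T)"
        by (intro sums_add sums_mult T sums_single)
      fix k
      consider "k = 0" | "0 < k" "k < l" | "k = l" | "k > l" by linarith
      then show "b k * r ^ k * (cos (real k * (2 * pi * real j / real l + t)) - 1) \<le>
              (if k = l then - (c * r ^ l) else 0) + 2 * (if k > l then w k * r ^ k else 0)"
      proof cases
        case 3
        have "b l * r ^ l * (cos (real l * (2 * pi * real j / real l + t)) - 1) \<le> b l * r ^ l * (cos (l * \<tau>) - 1)"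
          using cos_l l r' by (intro mult_left_mono) auto
        then show ?thesis using 3 by (simp add: c_def algebra_simps)
      next
        case 4
        then show ?thesis using arc_term_le[OF r'(1), of "b k" k] by (simp add: w_def)
      qed (use l in auto)
    qed
    also have "2 * T \<le> 2 * ((r / \<rho>) ^ Suc l * W)" using T by simp
    also have "\<dots> = (2 * W / \<rho> ^ Suc l * r) * r ^ l" by (simp add: power_divide)
    also have "\<dots> \<le> c / 2 * r ^ l"
    proof (rule mult_right_mono)
      have "r \<le> c * \<rho> ^ Suc l / (4 * W + 1)" using r by (simp add: r0_def)
      then have "r * (4 * W + 1) \<le> c * \<rho> ^ Suc l" using W by (simp add: pos_le_divide_eq)
      then have "r * (4 * W) \<le> c * \<rho> ^ Suc l" using r' by (simp add: distrib_left)
      then show "2 * W / \<rho> ^ Suc l * r \<le> c / 2" using \<rho> by (simp add: field_simps)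
    qed (use r' in auto)
    finally show ?thesis by (simp add: algebra_simps)
  qed
  then show ?thesis using c r0 by (intro exI[of _ "c / 2"] conjI exI[of _ r0]) auto
qed

text \<open>
  Close to \<open>2\<pi>j/l\<close> the terms fall into two groups. For \<open>l dvd j * k\<close> the cosine depends on
  the offset \<open>t\<close> alone, and these terms add up to at most \<open>(1 - cos t) (- b\<^sub>l r\<^sup>l + O(r\<^sup>l\<^sup>+\<^sup>1)) \<le> 0\<close>. The others start
  with the index \<open>L\<close>, whose cosine stays below \<open>1\<close> by continuity. A single small
  parameter \<open>\<tau>\<close> bounds the radius and the offset and serves as the constant, so that
  finitely many \<open>j\<close> can be treated at once.
\<close>

lemma arc_sum_near:
  fixes b :: "nat \<Rightarrow> real"
  assumes sum: "summable (\<lambda>k. \<bar>b k\<bar> * (1 + (real k)\<^sup>2) * \<rho> ^ k)" and \<rho>: "0 < \<rho>"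
    and l: "l > 0" "\<And>k. 0 < k \<Longrightarrow> k < l \<Longrightarrow> b k = 0" "b l > 0"
    and L: "l < L" "\<not> l dvd j * L" "b L > 0" "\<And>k. k < L \<Longrightarrow> \<not> l dvd j * k \<Longrightarrow> b k = 0"
  shows "\<forall>\<^sub>F \<tau> in at_right 0. \<forall>r t. 0 < r \<longrightarrow> r < \<tau> \<longrightarrow> \<bar>t\<bar> < \<tau> \<longrightarrow>
           arc_sum b r (2 * pi * real j / real l + t) \<le> - \<tau> * r ^ L"
proof -
  define w where "w k = \<bar>b k\<bar> * (1 + (real k)\<^sup>2)" for k
  define W where "W = (\<Sum>k. w k * \<rho> ^ k)"
  define \<theta> where "\<theta> = 2 * pi * real j / real l"
  define c where "c = (1 - cos (L * \<theta>)) / 2"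
  have w0: "w k \<ge> 0" for k by (simp add: w_def)
  have sumw: "summable (\<lambda>k. w k * \<rho> ^ k)" using sum by (simp add: w_def)
  have W: "W \<ge> 0"
    unfolding W_def by (rule suminf_nonneg[OF sumw]) (use w0 \<rho> in auto)
  have res: "real k * (\<theta> + t) = real k * t + 2 * pi * (real (j * k) / real l)" for k t
    by (simp add: \<theta>_def field_simps)
  have "cos (L * \<theta>) \<noteq> 1"
    using L(2) l unfolding \<theta>_def by (simp only: cos_multiple_root_angle_eq_1_iff not_False_eq_True)
  then have c: "c > 0"
    using cos_le_one[of "L * \<theta>"] unfolding c_def by (auto simp: less_le)
  have "isCont (\<lambda>t. cos (real L * (\<theta> + t))) 0"
    by (intro continuous_intros)
  then have "\<forall>\<^sub>F t in at 0. dist (cos (real L * (\<theta> + t))) (cos (real L * (\<theta> + 0))) < c"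
    using c unfolding isCont_def by (rule tendstoD)
  then obtain d where d: "d > 0" "\<And>t. t \<noteq> 0 \<Longrightarrow> \<bar>t\<bar> < d \<Longrightarrow> dist (cos (real L * (\<theta> + t))) (cos (real L * \<theta>)) < c"
    unfolding eventually_at by (auto simp: dist_real_def)
  have cosL: "cos (real L * (\<theta> + t)) - 1 \<le> - c" if "\<bar>t\<bar> < d" for t
  proof -
    have "cos (real L * \<theta>) - 1 = - 2 * c" by (simp add: c_def)
    then show ?thesis
      using d(2)[of t] that c by (cases "t = 0") (simp_all add: dist_real_def abs_less_iff)
  qed
  define \<tau>0 where "\<tau>0 = Min {d, \<rho>, pi / real l, b l * \<rho> ^ Suc l / (W + 1), b L * c / 2, b L * c * \<rho> ^ Suc L / (4 * W + 1)}"
  have \<tau>0: "\<tau>0 > 0" 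
  proof -
    have "0 < pi / real l" "0 < b l * \<rho> ^ Suc l / (W + 1)" "0 < b L * c / 2" "0 < b L * c * \<rho> ^ Suc L / (4 * W + 1)"
      using \<rho> l(1,3) L(3) c W by (intro divide_pos_pos mult_pos_pos add_nonneg_pos zero_less_power; simp)+
    then show ?thesis using d(1) \<rho> unfolding \<tau>0_def by simp
  qed
  have "arc_sum b r (\<theta> + t) \<le> - \<tau> * r ^ L" if \<tau>: "\<tau> < \<tau>0" and r: "0 < r" "r < \<tau>" and t: "\<bar>t\<bar> < \<tau>" for \<tau> r t
  proof -
    have bounds: "\<tau> < d" "\<tau> < \<rho>" "\<tau> < pi / real l" "\<tau> < b l * \<rho> ^ Suc l / (W + 1)" "\<tau> < b L * c / 2" "\<tau> < b L * c * \<rho> ^ Suc L / (4 * W + 1)"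
      using \<tau> by (auto simp: \<tau>0_def)
    have r': "0 \<le> r" "r \<le> \<rho>" using r bounds by auto
    have "\<forall>K. \<exists>T. (\<lambda>k. if k > K then w k * r ^ k else 0) sums T \<and> T \<le> (r / \<rho>) ^ Suc K * W"
      unfolding W_def by (rule allI, rule power_series_tail_bound[OF sumw w0 r' \<rho>]) blast
    from choice[OF this] obtain T
      where "\<forall>K. (\<lambda>k. if k > K then w k * r ^ k else 0) sums T K \<and> T K \<le> (r / \<rho>) ^ Suc K * W" ..
    then have T: "(\<lambda>k. if k > K then w k * r ^ k else 0) sums T K" "T K \<le> (r / \<rho>) ^ Suc K * W" for K
      by simp_all
    define u where "u = 1 - cos t"
    have u: "u \<ge> 0" by (simp add: u_def)
    have "1 * \<bar>t\<bar> \<le> real l * \<bar>t\<bar>"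
      using l by (intro mult_right_mono) auto
    moreover have "real l * \<bar>t\<bar> \<le> real l * (pi / real l)"
      using t bounds by (intro mult_left_mono) auto
    moreover have "real l * (pi / real l) = pi"
      using l by simp
    ultimately have "cos (real l * \<bar>t\<bar>) \<le> cos \<bar>t\<bar>"
      by (intro cos_monotone_0_pi_le) auto
    then have lt: "cos (real l * t) - 1 \<le> - u"
      unfolding u_def by (metis abs_if abs_of_nat abs_mult cos_abs_real diff_right_mono minus_diff_eq)
    have "arc_sum b r (\<theta> + t) \<le> u * (- (b l * r ^ l) + T l) + - (b L * c * r ^ L) + 2 * T L"
    proof (rule arc_sum_le[OF sum r'])
      let ?e = "\<lambda>k. u * ((if k = l then - (b l * r ^ l) else 0) + (if k > l then w k * r ^ k else 0))
            + (if k = L then - (b L * c * r ^ L) else 0) + 2 * (if k > L then w k * r ^ k else 0)"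
      show "?e sums (u * (- (b l * r ^ l) + T l) + - (b L * c * r ^ L) + 2 * T L)"
        by (intro sums_add sums_mult T sums_single)
      fix k
      have wk: "0 \<le> w k * r ^ k" using w0 r' by simp
      show "b k * r ^ k * (cos (real k * (\<theta> + t)) - 1) \<le> ?e k"
      proof (cases "l dvd j * k")
        case True
        then obtain i where "j * k = l * i" by auto
        then have "real k * (\<theta> + t) = real k * t + 2 * pi * real i"
          using l unfolding res by simp
        then have cos_k: "cos (real k * (\<theta> + t)) = cos (real k * t)"
          by (simp only: cos_add_2pi_nat)
        consider "k = 0" | "0 < k" "k < l" | "k = l" | "k > l" by linarith
        then show ?thesis
        proof cases
          case 3
          have "b l * r ^ l * (cos (real l * t) - 1) \<le> b l * r ^ l * (- u)"
            using lt l r' by (intro mult_left_mono) auto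
          then show ?thesis using 3 L cos_k by (simp add: mult_ac)
        next
          case 4
          have "b k * r ^ k * (cos (real k * t) - 1) = - b k * r ^ k * (1 - cos (real k * t))"
            by (simp add: algebra_simps)
          also have "\<dots> \<le> \<bar>b k\<bar> * r ^ k * ((1 + (real k)\<^sup>2) * u)"
          proof (intro mult_mono)
            show "1 - cos (real k * t) \<le> (1 + (real k)\<^sup>2) * u"
              using one_minus_cos_mult_le[of k t] mult_right_mono[of "(real k)\<^sup>2" "1 + (real k)\<^sup>2" u, OF _ u]
              unfolding u_def by linarith
          qed (use r' in auto)
          also have "\<dots> = u * (w k * r ^ k)"
            by (simp add: w_def mult_ac)
          finally show ?thesis using 4 L True wk by (auto simp: cos_k)
        qed (use l L in auto)
      next
        case False
        then have kl: "k \<noteq> l" by auto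
        consider "k < L" | "k = L" | "k > L" by linarith
        then show ?thesis
        proof cases
          case 1
          then show ?thesis using L(4)[OF 1 False] kl u wk by auto
        next
          case 2
          have "b L * r ^ L * (cos (real L * (\<theta> + t)) - 1) \<le> b L * r ^ L * (- c)"
            using cosL[of t] t bounds L r' by (intro mult_left_mono) auto
          also have "\<dots> = - (b L * c * r ^ L)" by simp
          finally have "b L * r ^ L * (cos (real L * (\<theta> + t)) - 1) \<le> - (b L * c * r ^ L)" .
          moreover have "0 \<le> u * (w k * r ^ k)" using u wk by simp
          ultimately show ?thesis using 2 L(1) by simp
        next
          case 3
          have "0 \<le> u * (w k * r ^ k)" using u wk by simp
          then show ?thesis
            using 3 L(1) arc_term_le[OF r'(1), of "b k" k "real k * (\<theta> + t)"] by (simp add: w_def)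
        qed
      qed
    qed
    also have "u * (- (b l * r ^ l) + T l) \<le> 0"
    proof -
      have "T l \<le> (W / \<rho> ^ Suc l * r) * r ^ l"
        using T(2)[of l] by (simp add: power_divide mult_ac)
      also have "\<dots> \<le> b l * r ^ l"
      proof (rule mult_right_mono)
        have "r \<le> b l * \<rho> ^ Suc l / (W + 1)" using r bounds by simp
        then have "r * (W + 1) \<le> b l * \<rho> ^ Suc l" using W by (simp add: pos_le_divide_eq)
        then have "r * W \<le> b l * \<rho> ^ Suc l" using r' by (simp add: distrib_left)
        then show "W / \<rho> ^ Suc l * r \<le> b l" using \<rho> by (simp add: field_simps)
      qed (use r' in auto)
      finally show ?thesis using u by (simp add: mult_nonneg_nonpos)
    qed
    also have "2 * T L \<le> (b L * c / 2) * r ^ L"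
    proof -
      have "2 * T L \<le> (2 * W / \<rho> ^ Suc L * r) * r ^ L"
        using mult_left_mono[OF T(2)[of L], of 2] by (simp add: power_divide mult_ac)
      also have "\<dots> \<le> b L * c / 2 * r ^ L"
      proof (rule mult_right_mono)
        have "r \<le> b L * c * \<rho> ^ Suc L / (4 * W + 1)" using r bounds by simp
        then have "r * (4 * W + 1) \<le> b L * c * \<rho> ^ Suc L" using W by (simp add: pos_le_divide_eq)
        then have "r * (4 * W) \<le> b L * c * \<rho> ^ Suc L" using r' by (simp add: distrib_left)
        then show "2 * W / \<rho> ^ Suc L * r \<le> b L * c / 2" using \<rho> by (simp add: field_simps)
      qed (use r' in auto)
      finally show ?thesis .
    qed
    finally have "arc_sum b r (\<theta> + t) \<le> - (b L * c / 2) * r ^ L"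
      by (simp add: algebra_simps)
    also have "\<dots> \<le> - \<tau> * r ^ L"
      using bounds r' by (intro mult_right_mono) auto
    finally show ?thesis .
  qed
  then show ?thesis
    unfolding eventually_at_right_field \<theta>_def using \<tau>0 by blast
qed

text \<open>
  At the angle \<open>2\<pi>j/l\<close> itself only indices with \<open>l\<close> not dividing \<open>j * k\<close> contribute. The first of
  them determines the sign for small \<open>r\<close>, and a negative \<open>b\<^sub>L\<close> would make the sum positive.
\<close>

lemma arc_sum_leading_positive:
  fixes b :: "nat \<Rightarrow> real"
  assumes sum: "summable (\<lambda>k. \<bar>b k\<bar> * (1 + (real k)\<^sup>2) * \<rho> ^ k)" and \<rho>: "0 < \<rho>" and l: "l > 0"
    and L: "\<not> l dvd j * L" "b L \<noteq> 0" "\<And>k. k < L \<Longrightarrow> \<not> l dvd j * k \<Longrightarrow> b k = 0"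
    and neg: "\<forall>\<^sub>F r in at_right 0. arc_sum b r (2 * pi * real j / real l) < 0"
  shows "b L > 0"
proof (rule ccontr)
  assume "\<not> b L > 0"
  with L have bL: "b L < 0" by simp
  define w where "w k = \<bar>b k\<bar> * (1 + (real k)\<^sup>2)" for k
  define W where "W = (\<Sum>k. w k * \<rho> ^ k)"
  define \<theta> where "\<theta> = 2 * pi * real j / real l"
  define c where "c = 1 - cos (L * \<theta>)"
  have w0: "w k \<ge> 0" for k by (simp add: w_def)
  have sumw: "summable (\<lambda>k. w k * \<rho> ^ k)" using sum by (simp add: w_def)
  have W: "W \<ge> 0"
    unfolding W_def by (rule suminf_nonneg[OF sumw]) (use w0 \<rho> in auto)
  have "cos (L * \<theta>) \<noteq> 1"
    using L(1) l unfolding \<theta>_def by (simp only: cos_multiple_root_angle_eq_1_iff not_False_eq_True)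
  then have c: "c > 0"
    using cos_le_one[of "L * \<theta>"] unfolding c_def by (auto simp: less_le)
  have sum': "summable (\<lambda>k. \<bar>- b k\<bar> * (1 + (real k)\<^sup>2) * \<rho> ^ k)"
    using sum by simp
  define r0 where "r0 = min \<rho> (- b L * c * \<rho> ^ Suc L / (2 * W + 1))"
  have r0: "r0 > 0" using \<rho> c W bL by (simp add: r0_def mult_neg_pos divide_neg_pos)
  have nonneg: "arc_sum b r \<theta> \<ge> 0" if r: "0 < r" "r < r0" for r
  proof -
    have r': "0 \<le> r" "r \<le> \<rho>" using r by (auto simp: r0_def)
    obtain T where T: "(\<lambda>k. if k > L then w k * r ^ k else 0) sums T" "0 \<le> T" "T \<le> (r / \<rho>) ^ Suc L * W"
      unfolding W_def by (rule power_series_tail_bound[OF sumw w0 r' \<rho>])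
    have "arc_sum (\<lambda>k. - b k) r \<theta> \<le> b L * c * r ^ L + 2 * T"
    proof (rule arc_sum_le[OF sum' r'])
      show "(\<lambda>k. (if k = L then b L * c * r ^ L else 0) + 2 * (if k > L then w k * r ^ k else 0)) sums (b L * c * r ^ L + 2 * T)"
        by (intro sums_add sums_mult T sums_single)
      fix k
      consider "k < L" "l dvd j * k" | "k < L" "\<not> l dvd j * k" | "k = L" | "k > L" by linarith
      then show "- b k * r ^ k * (cos (real k * \<theta>) - 1) \<le>
              (if k = L then b L * c * r ^ L else 0) + 2 * (if k > L then w k * r ^ k else 0)"
      proof cases
        case 1
        then show ?thesis using l cos_multiple_root_angle_eq_1_iff[of l k j] by (simp add: \<theta>_def)
      next
        case 4
        then show ?thesis using arc_term_le[OF r'(1), of "- b k" k] by (simp add: w_def)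
      qed (use L in \<open>auto simp: c_def algebra_simps\<close>)
    qed
    also have "2 * T \<le> (2 * W / \<rho> ^ Suc L * r) * r ^ L"
      using mult_left_mono[OF T(3), of 2] by (simp add: power_divide mult_ac)
    also have "\<dots> \<le> (- b L * c) * r ^ L"
    proof (rule mult_right_mono)
      have "r \<le> - b L * c * \<rho> ^ Suc L / (2 * W + 1)" using r by (simp add: r0_def)
      then have "r * (2 * W + 1) \<le> - b L * c * \<rho> ^ Suc L"
        by (rule pos_le_divide_eq[THEN iffD1, rotated]) (use W in auto)
      then have "r * (2 * W) \<le> - b L * c * \<rho> ^ Suc L" using r' by (simp add: distrib_left)
      then show "2 * W / \<rho> ^ Suc L * r \<le> - b L * c" using \<rho> by (simp add: field_simps)
    qed (use r' in auto)
    finally have "arc_sum (\<lambda>k. - b k) r \<theta> \<le> 0" by simp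
    moreover have "arc_sum (\<lambda>k. - b k) r \<theta> = - arc_sum b r \<theta>"
      unfolding arc_sum_def using suminf_minus[OF summable_arc_sum[OF sum r', of \<theta>]] by simp
    ultimately show ?thesis by simp
  qed
  have "\<forall>\<^sub>F r in at_right 0. arc_sum b r \<theta> \<ge> 0"
    unfolding eventually_at_right_field using r0 nonneg by blast
  with neg have "\<forall>\<^sub>F r :: real in at_right 0. False"
    unfolding \<theta>_def by eventually_elim auto
  then show False by simp
qed

text \<open>
  Every angle in \<open>[0, \<pi>]\<close> lies within \<open>\<pi>/l\<close> of some \<open>2\<pi>j/l\<close> with \<open>0 \<le> j \<le> l div 2\<close>. Angles
  near \<open>2\<pi>j/l\<close> with \<open>j > 0\<close> are covered by \<open>arc_sum_near\<close>, all others by \<open>arc_sum_far\<close>.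
  Negative angles are covered because the sum is even.
\<close>

lemma minor_arc_bound:
  fixes b :: "nat \<Rightarrow> real"
  assumes sum: "summable (\<lambda>k. \<bar>b k\<bar> * (1 + (real k)\<^sup>2) * \<rho> ^ k)" and \<rho>: "0 < \<rho>"
    and l: "l > 0" "\<And>k. 0 < k \<Longrightarrow> k < l \<Longrightarrow> b k = 0" "b l > 0" "l \<le> L"
    and Lj: "\<And>j. 1 \<le> j \<Longrightarrow> j \<le> l div 2 \<Longrightarrow> \<exists>L'. l < L' \<and> L' \<le> L \<and> \<not> l dvd j * L' \<and> b L' > 0 \<and>
                (\<forall>k<L'. \<not> l dvd j * k \<longrightarrow> b k = 0)"
    and \<eta>: "0 < \<eta>"
  shows "\<exists>c>0. \<exists>r0>0. \<forall>r \<theta>. 0 < r \<longrightarrow> r < r0 \<longrightarrow> \<eta> \<le> \<bar>\<theta>\<bar> \<longrightarrow> \<bar>\<theta>\<bar> \<le> pi \<longrightarrow> arc_sum b r \<theta> \<le> - c * r ^ L"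
proof -
  define J where "J = {1..l div 2}"
  have near: "\<forall>j\<in>J. \<forall>\<^sub>F \<tau> in at_right 0. \<exists>L'. l < L' \<and> L' \<le> L \<and> (\<forall>r t. 0 < r \<longrightarrow> r < \<tau> \<longrightarrow> \<bar>t\<bar> < \<tau> \<longrightarrow>
           arc_sum b r (2 * pi * real j / real l + t) \<le> - \<tau> * r ^ L')"
  proof
    fix j assume "j \<in> J"
    then obtain L' where L': "l < L'" "L' \<le> L" "\<not> l dvd j * L'" "b L' > 0" "\<And>k. k < L' \<Longrightarrow> \<not> l dvd j * k \<Longrightarrow> b k = 0"
      using Lj[of j] by (auto simp: J_def)
    show "\<forall>\<^sub>F \<tau> in at_right 0. \<exists>L'. l < L' \<and> L' \<le> L \<and> (\<forall>r t. 0 < r \<longrightarrow> r < \<tau> \<longrightarrow> \<bar>t\<bar> < \<tau> \<longrightarrow>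
           arc_sum b r (2 * pi * real j / real l + t) \<le> - \<tau> * r ^ L')"
      by (rule eventually_mono[OF arc_sum_near[OF sum \<rho> l(1-3) L'(1,3,4,5)]]) (use L' in blast)+
  qed
  have "\<forall>\<^sub>F \<tau> in at_right 0. (\<forall>j\<in>J. \<exists>L'. l < L' \<and> L' \<le> L \<and> (\<forall>r t. 0 < r \<longrightarrow> r < \<tau> \<longrightarrow> \<bar>t\<bar> < \<tau> \<longrightarrow>
           arc_sum b r (2 * pi * real j / real l + t) \<le> - \<tau> * r ^ L')) \<and> 0 < \<tau> \<and> \<tau> < \<eta>"
    using near \<eta> by (intro eventually_conj eventually_ball_finite eventually_at_right_less eventually_at_rightI[of 0 \<eta>])
      (auto simp: J_def)
  then obtain \<tau> where \<tau>: "0 < \<tau>" "\<tau> < \<eta>" and near': "\<And>j. j \<in> J \<Longrightarrow> \<exists>L'. l < L' \<and> L' \<le> L \<and> (\<forall>r t. 0 < r \<longrightarrow> r < \<tau> \<longrightarrow> \<bar>t\<bar> < \<tau> \<longrightarrow>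
           arc_sum b r (2 * pi * real j / real l + t) \<le> - \<tau> * r ^ L')"
    using eventually_happens'[OF trivial_limit_at_right_real] by blast
  obtain c r0 where c: "c > 0" "r0 > 0" and far: "\<And>r j t. 0 < r \<Longrightarrow> r < r0 \<Longrightarrow> \<tau> \<le> \<bar>t\<bar> \<Longrightarrow> \<bar>t\<bar> \<le> pi / l \<Longrightarrow>
           arc_sum b r (2 * pi * real j / real l + t) \<le> - c * r ^ l"
    using arc_sum_far[OF sum \<rho> l(1-3) \<tau>(1)] by blast
  have bound: "arc_sum b r \<theta> \<le> - min c \<tau> * r ^ L"
    if r: "0 < r" "r < min (min r0 \<tau>) 1" and \<theta>: "\<eta> \<le> \<bar>\<theta>\<bar>" "\<bar>\<theta>\<bar> \<le> pi" for r \<theta>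
  proof -
    define y where "y = real l * \<bar>\<theta>\<bar> / (2 * pi)"
    \<comment> \<open>Rounding half down keeps \<open>j\<close> at most \<open>l div 2\<close> also for odd \<open>l\<close> and \<open>\<theta> = \<pi>\<close>.\<close>
    define j where "j = nat \<lceil>y - 1 / 2\<rceil>"
    define t where "t = \<bar>\<theta>\<bar> - 2 * pi * real j / real l"
    have y: "0 \<le> y" "y \<le> real l / 2"
      using \<theta> l by (auto simp: y_def field_simps)
    have "\<lceil>y - 1 / 2\<rceil> \<ge> 0" using y by linarith
    then have j: "real j - 1 < y - 1 / 2" "y - 1 / 2 \<le> real j"
      unfolding j_def by (simp_all add: of_nat_nat) linarith+
    have "real (2 * j) < real (l + 1)" using j y by simp
    then have jl: "j \<le> l div 2" by linarith
    have t_eq: "t = (y - real j) * (2 * pi / real l)"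
      using l by (simp add: t_def y_def field_simps)
    have "\<bar>y - real j\<bar> \<le> 1 / 2" using j by linarith
    then have "\<bar>t\<bar> \<le> 1 / 2 * (2 * pi / real l)"
      unfolding t_eq abs_mult using l by (intro mult_mono) auto
    then have t: "\<bar>t\<bar> \<le> pi / real l" by simp
    have "cos (real k * \<theta>) = cos (real k * \<bar>\<theta>\<bar>)" for k
      by (metis abs_if abs_of_nat abs_mult cos_abs_real)
    then have "arc_sum b r \<theta> = arc_sum b r (2 * pi * real j / real l + t)"
      by (simp add: arc_sum_def t_def)
    also have "\<dots> \<le> - min c \<tau> * r ^ L"
    proof (cases "\<tau> \<le> \<bar>t\<bar>")
      case True
      have "arc_sum b r (2 * pi * real j / real l + t) \<le> - (c * r ^ l)"
        using far[of r t j] True t r by simp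
      moreover have "min c \<tau> * r ^ L \<le> c * r ^ l"
        using c \<tau> r l by (intro mult_mono power_decreasing) auto
      ultimately show ?thesis by simp
    next
      case False
      have "j \<noteq> 0"
      proof
        assume "j = 0"
        then show False using False \<theta> \<tau> by (simp add: t_def)
      qed
      then have "j \<in> J" using jl by (simp add: J_def)
      then obtain L' where L': "l < L'" "L' \<le> L" "arc_sum b r (2 * pi * real j / real l + t) \<le> - (\<tau> * r ^ L')"
        using near' r False by fastforce
      moreover have "min c \<tau> * r ^ L \<le> \<tau> * r ^ L'"
        using c \<tau> r L' by (intro mult_mono power_decreasing) auto
      ultimately show ?thesis by simp
    qed
    finally show ?thesis .
  qed
  have "0 < min c \<tau>" "0 < min (min r0 \<tau>) 1"
    using c \<tau>(1) by simp_all
  then show ?thesis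
    using bound by blast
qed

section \<open>The function phi near the saddle point\<close>

lemma eval_fps_leading_bounds:
  fixes g :: "real fps"
  assumes rad: "fps_conv_radius g > 0" and zero: "\<And>k. k < l \<Longrightarrow> fps_nth g k = 0" and pos: "fps_nth g l > 0"
  shows "\<forall>\<^sub>F r in at_right 0. fps_nth g l / 2 * r ^ l \<le> eval_fps g r \<and> eval_fps g r \<le> 2 * fps_nth g l * r ^ l"
proof -
  have lim: "((\<lambda>r. eval_fps g r / r ^ l) \<longlongrightarrow> fps_nth g l) (at_right 0)"
    using tendsto_eval_fps_leading[OF rad zero] by (rule filterlim_mono) (auto simp: at_le)
  have "\<forall>\<^sub>F r in at_right 0. fps_nth g l / 2 < eval_fps g r / r ^ l"
    by (rule order_tendstoD[OF lim]) (use pos in simp)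
  moreover have "\<forall>\<^sub>F r in at_right 0. eval_fps g r / r ^ l < 2 * fps_nth g l"
    by (rule order_tendstoD[OF lim]) (use pos in simp)
  ultimately show ?thesis
    using eventually_at_right_less[of 0] by eventually_elim (auto simp: field_simps)
qed

lemma norm_eval_fps_leading_bound:
  fixes g :: "complex fps"
  assumes rad: "fps_conv_radius g > 0" and zero: "\<And>k. k < l \<Longrightarrow> fps_nth g k = 0" and l: "l > 0"
  shows "\<exists>d>0. \<forall>z. norm z < d \<longrightarrow> norm (eval_fps g z) \<le> (norm (fps_nth g l) + 1) * norm z ^ l"
proof -
  have "((\<lambda>z. norm (eval_fps g z / z ^ l)) \<longlongrightarrow> norm (fps_nth g l)) (at 0)"
    by (intro tendsto_norm tendsto_eval_fps_leading rad zero)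
  then have "\<forall>\<^sub>F z in at 0. norm (eval_fps g z / z ^ l) < norm (fps_nth g l) + 1"
    by (rule order_tendstoD) simp
  then obtain d where d: "d > 0" "\<And>z. z \<noteq> 0 \<Longrightarrow> norm z < d \<Longrightarrow> norm (eval_fps g z / z ^ l) < norm (fps_nth g l) + 1"
    unfolding eventually_at by auto
  have "norm (eval_fps g z) \<le> (norm (fps_nth g l) + 1) * norm z ^ l" if "norm z < d" for z
    using d(2)[of z] that l zero[of 0]
    by (cases "z = 0") (auto simp: eval_fps_at_0 norm_divide norm_power field_simps)
  with d show ?thesis by blast
qed

lemma has_field_derivative_eval_fps_exp:
  fixes G :: "complex fps"
  assumes "ereal (norm (a * exp z)) < fps_conv_radius G"
  shows "((\<lambda>z. eval_fps G (a * exp z)) has_field_derivative eval_fps (fps_XD G) (a * exp z)) (at z)"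
proof -
  have "((eval_fps G \<circ> (\<lambda>z. a * exp z)) has_field_derivative eval_fps (fps_deriv G) (a * exp z) * (a * exp z)) (at z)"
    by (intro DERIV_chain has_field_derivative_eval_fps assms) (auto intro!: derivative_eq_intros)
  then show ?thesis
    using assms by (simp add: o_def eval_fps_XD mult.commute)
qed

text \<open>
  The function \<open>E(z) = h(r e\<^sup>z) - h(r) - \<mu> z\<close> vanishes to second order at the origin, with
  second derivative \<open>\<sigma>\<close>. Hence \<open>\<phi>\<close> is \<open>2 / \<sigma>\<close> times the power series of \<open>E\<close> shifted by two places, and the
  value \<open>1\<close> prescribed at \<open>0\<close> is the one that continues it analytically. Its bound on the unit circle
  extends to the disc by the maximum principle. As \<open>h\<close> is small, the imaginary part of
  \<open>h(r e\<^sup>z) - h(r)\<close> stays within \<open>(-\<pi>, \<pi>)\<close>, and the principal logarithm recovers this difference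
  from its exponential.
\<close>

lemma phi_holomorphic_bounded:
  fixes f :: "real fps" and r C K :: real
  defines "H \<equiv> eval_fps (complex_fps (log_fps f))"
  assumes f0: "fps_nth f 0 = 1" and r: "0 < r"
    and rad: "ereal (r * exp 2) < fps_conv_radius f" "ereal (r * exp 2) < fps_conv_radius (log_fps f)"
    and bound: "\<And>w. norm w \<le> r * exp 2 \<Longrightarrow> norm (H w) \<le> C * norm w ^ l"
    and C: "0 \<le> C" "C * (r * exp 2) ^ l \<le> 1"
    and pos: "sigma_f f r > 0" "mu_f f r \<ge> 0" "mu_f f r \<le> K * sigma_f f r" "r ^ l \<le> K * sigma_f f r"
  shows "phi f r holomorphic_on cball 0 1"
    and "\<And>z. norm z \<le> 1 \<Longrightarrow> norm (phi f r z) \<le> 2 * (2 * C * exp 2 ^ l + 1) * K"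
    and "\<And>z. norm z \<le> 1 \<Longrightarrow> H (of_real r * exp z) - H (of_real r) - of_real (mu_f f r) * z =
            of_real (sigma_f f r) * z\<^sup>2 / 2 * phi f r z"
proof -
  define h where "h = complex_fps (log_fps f)"
  define E where "E z = H (of_real r * exp z) - H (of_real r) - of_real (mu_f f r) * z" for z
  have in_disc: "norm (of_real r * exp z) \<le> r * exp 2" if "norm z < 2" for z :: complex
    using that r complex_Re_le_cmod[of z] by (simp add: norm_mult)
  have radz: "ereal (norm (of_real r * exp z)) < fps_conv_radius f \<and> ereal (norm (of_real r * exp z)) < fps_conv_radius h"
    if "norm z < 2" for z :: complex
    using in_disc[OF that] rad unfolding h_def
    by (auto intro: le_less_trans[of _ "ereal (r * exp 2)"] simp del: times_ereal.simps)
  have H_small: "norm (H (of_real r * exp z)) \<le> C * (r * exp 2) ^ l" if "norm z < 2" for z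
    using bound[OF in_disc[OF that]] mult_left_mono[OF power_mono[OF in_disc[OF that]], of C l] C by simp
  have h_def': "H = eval_fps h" by (simp add: H_def h_def)
  have DE: "(E has_field_derivative (eval_fps (fps_XD h) (of_real r * exp z) - of_real (mu_f f r))) (at z)"
    if "norm z < 2" for z
    unfolding E_def h_def' using radz[OF that]
    by (intro DERIV_cong[OF DERIV_diff[OF DERIV_diff[OF has_field_derivative_eval_fps_exp DERIV_const] DERIV_cmult_Id]]) auto
  have holoE: "E holomorphic_on ball 0 2"
    unfolding holomorphic_on_open[OF open_ball] by (intro ballI exI, rule DE) simp
  define e where "e = fps_expansion E 0"
  have e: "E has_fps_expansion e"
    unfolding e_def using holoE by (intro has_fps_expansion_fps_expansion[of "ball 0 2"]) auto
  have e_rad: "fps_conv_radius e \<ge> ereal 2"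
    unfolding e_def using holoE by (intro conv_radius_fps_expansion) (simp only: eball_ereal)
  have e_eval: "eval_fps e z = E z" if "norm z < 2" for z
    unfolding e_def using holoE that
    by (subst eval_fps_expansion'[where r = "ereal 2"]) (auto simp only: eball_ereal ereal_less_eq less_ereal.simps add_0_left)
  have r2: "ereal \<bar>r\<bar> < fps_conv_radius f" "ereal \<bar>r\<bar> < fps_conv_radius (log_fps f)"
    using radz[of 0] r by (auto simp: h_def)
  have e0: "fps_nth e 0 = 0"
    unfolding fps_nth_fps_expansion[OF e] by (simp add: E_def)
  have mu: "of_real (mu_f f r) = eval_fps (fps_XD h) (of_real r)"
    unfolding h_def complex_fps_XD[symmetric] mu_f_eq[OF f0 r2]
    by (rule eval_complex_fps_of_real[symmetric]) (use r2 fps_conv_radius_XD[of "log_fps f"] in \<open>auto intro: less_le_trans\<close>)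
  have sigma: "of_real (sigma_f f r) = eval_fps (fps_XD (fps_XD h)) (of_real r)"
    unfolding h_def complex_fps_XD[symmetric] sigma_f_eq[OF f0 r2]
    by (rule eval_complex_fps_of_real[symmetric])
       (use r2 fps_conv_radius_XD[of "log_fps f"] fps_conv_radius_XD[of "fps_XD (log_fps f)"] in \<open>auto intro: less_le_trans\<close>)
  have "deriv E 0 = 0"
    using DERIV_imp_deriv[OF DE[of 0]] mu by simp
  then have e1: "fps_nth e 1 = 0"
    unfolding fps_nth_fps_expansion[OF e] by simp
  have "deriv (deriv E) 0 = of_real (sigma_f f r)"
  proof -
    have "\<forall>\<^sub>F z in nhds 0. z \<in> ball 0 2"
      by (rule eventually_nhds_in_open) auto
    then have "\<forall>\<^sub>F z in nhds 0. deriv E z = eval_fps (fps_XD h) (of_real r * exp z) - of_real (mu_f f r)"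
      by eventually_elim (use DE in \<open>auto intro: DERIV_imp_deriv\<close>)
    then have "deriv (deriv E) 0 = deriv (\<lambda>z. eval_fps (fps_XD h) (of_real r * exp z) - of_real (mu_f f r)) 0"
      by (rule deriv_cong_ev) simp
    also have "\<dots> = eval_fps (fps_XD (fps_XD h)) (of_real r * exp 0)"
      using radz[of 0] fps_conv_radius_XD[of h]
      by (intro DERIV_imp_deriv DERIV_cong[OF DERIV_diff[OF has_field_derivative_eval_fps_exp DERIV_const]])
         (auto intro: less_le_trans)
    finally show ?thesis by (simp add: sigma)
  qed
  then have e2: "fps_nth e 2 = of_real (sigma_f f r) / 2"
    unfolding fps_nth_fps_expansion[OF e] by (simp add: numeral_2_eq_2)
  have "e \<noteq> 0" using e2 pos by auto
  then have sub: "2 \<le> subdegree e"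
    using e0 e1 by (intro subdegree_geI) (auto simp: numeral_2_eq_2 less_Suc_eq)
  define g where "g z = 2 / of_real (sigma_f f r) * eval_fps (fps_shift 2 e) z" for z
  have phi_g: "phi f r z = g z" if "norm z < 2" for z
  proof (cases "z = 0")
    case True
    then show ?thesis
      using pos e2 by (simp add: phi_def g_def eval_fps_at_0 field_simps numeral_2_eq_2)
  next
    case False
    have "eval_fps (complex_fps f) (of_real r * exp z) / of_real (eval_fps f r) =
          exp (H (of_real r * exp z) - H (of_real r))"
      using exp_eval_log_fps[OF f0, of "of_real r * exp z"] exp_eval_log_fps[OF f0, of "of_real r"] radz[OF that] r2
      by (simp add: exp_diff H_def h_def eval_complex_fps_of_real)
    moreover have "Ln (exp (H (of_real r * exp z) - H (of_real r))) = H (of_real r * exp z) - H (of_real r)"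
    proof -
      have "norm (H (of_real r * exp z) - H (of_real r)) \<le> 1 + 1"
        using H_small[OF that] H_small[of 0] C by (intro norm_triangle_le_diff add_mono) auto
      then have "\<bar>Im (H (of_real r * exp z) - H (of_real r))\<bar> < pi"
        using abs_Im_le_cmod[of "H (of_real r * exp z) - H (of_real r)"] pi_gt3 by linarith
      then show ?thesis by (intro Ln_exp) (auto simp: abs_less_iff)
    qed
    moreover have "eval_fps (fps_shift 2 e) z = E z / z\<^sup>2"
      using False that e_rad sub
      by (subst eval_fps_shift) (auto simp: e_eval intro!: less_le_trans[OF _ e_rad])
    ultimately show ?thesis
      using False by (simp add: phi_def g_def E_def)
  qed
  have "g holomorphic_on cball 0 1"
    unfolding g_def
    by (intro holomorphic_intros) (auto intro!: less_le_trans[OF _ e_rad])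
  then show holo: "phi f r holomorphic_on cball 0 1"
    by (rule holomorphic_transform) (auto simp: phi_g)
  show eq: "H (of_real r * exp z) - H (of_real r) - of_real (mu_f f r) * z =
            of_real (sigma_f f r) * z\<^sup>2 / 2 * phi f r z" if "norm z \<le> 1" for z
  proof (cases "z = 0")
    case False
    have "eval_fps (fps_shift 2 e) z = E z / z\<^sup>2"
      using False that e_rad sub
      by (subst eval_fps_shift) (auto simp: e_eval intro!: less_le_trans[OF _ e_rad])
    then show ?thesis
      using that False pos by (simp add: phi_g g_def E_def)
  qed simp
  have frontier: "norm (phi f r z) \<le> 2 * (2 * C * exp 2 ^ l + 1) * K" if z: "norm z = 1" for z
  proof -
    have "sigma_f f r / 2 * norm (phi f r z) = norm (of_real (sigma_f f r) * z\<^sup>2 / 2 * phi f r z)"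
      using pos z by (simp add: norm_mult norm_divide norm_power)
    also have "\<dots> = norm (H (of_real r * exp z) - H (of_real r) - of_real (mu_f f r) * z)"
      by (subst eq) (use z in auto)
    also have "\<dots> \<le> C * (r * exp 2) ^ l + C * (r * exp 2) ^ l + mu_f f r"
      using H_small[of z] H_small[of 0] z pos
      by (intro norm_triangle_le_diff add_mono) (auto simp: norm_mult)
    also have "\<dots> = (2 * C * exp 2 ^ l) * r ^ l + mu_f f r"
      by (simp add: power_mult_distrib)
    also have "\<dots> \<le> (2 * C * exp 2 ^ l) * (K * sigma_f f r) + K * sigma_f f r"
      using pos C by (intro add_mono mult_left_mono) auto
    finally have "sigma_f f r * norm (phi f r z) \<le> sigma_f f r * (2 * (2 * C * exp 2 ^ l + 1) * K)"
      by (simp add: algebra_simps)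
    then show ?thesis using pos by simp
  qed
  show "norm (phi f r z) \<le> 2 * (2 * C * exp 2 ^ l + 1) * K" if "norm z \<le> 1" for z
    by (rule maximum_modulus_frontier[of "phi f r" "cball 0 1"])
       (use frontier that holo in \<open>auto intro: holomorphic_on_subset holomorphic_on_imp_continuous_on\<close>)
qed

section \<open>The coefficient as an integral over a circle\<close>

lemma has_integral_exp_circle:
  fixes m :: int
  shows "((\<lambda>\<theta>. exp (\<i> * of_int m * of_real \<theta>)) has_integral (if m = 0 then 2 * pi else 0)) {-pi..pi}"
proof (cases "m = 0")
  case True
  then show ?thesis
    using has_integral_const_real[of "1::complex" "-pi" pi] by (simp add: scaleR_conv_of_real)
next
  case False
  have "((\<lambda>\<theta>. exp (\<i> * of_int m * of_real \<theta>)) has_integral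
     (exp (\<i> * of_int m * of_real pi) / (\<i> * of_int m) - exp (\<i> * of_int m * of_real (-pi)) / (\<i> * of_int m))) {-pi..pi}"
  proof (rule fundamental_theorem_of_calculus)
    fix x :: real
    have "((\<lambda>z. exp (\<i> * of_int m * z) / (\<i> * of_int m)) has_field_derivative exp (\<i> * of_int m * of_real x)) (at (of_real x))"
      using False by (auto intro!: derivative_eq_intros)
    then show "((\<lambda>\<theta>. exp (\<i> * of_int m * of_real \<theta>) / (\<i> * of_int m)) has_vector_derivative
       exp (\<i> * of_int m * of_real x)) (at x within {-pi..pi})"
      by (rule has_vector_derivative_real_field)
  qed simp
  moreover have "exp (\<i> * of_int m * of_real pi) = exp (\<i> * of_int m * of_real (-pi))"
    unfolding exp_eq by (intro exI[of _ m]) (simp add: algebra_simps)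
  ultimately show ?thesis using False by simp
qed

text \<open>
  The series converges uniformly on the circle and may be integrated term by term.
\<close>

lemma has_integral_fps_coeff:
  fixes G :: "complex fps"
  assumes r: "0 \<le> r" "ereal r < fps_conv_radius G"
  shows "((\<lambda>\<theta>. eval_fps G (of_real r * exp (\<i> * of_real \<theta>)) * exp (- \<i> * of_nat k * of_real \<theta>))
           has_integral 2 * pi * fps_nth G k * of_real r ^ k) {-pi..pi}"
proof -
  define t where "t j \<theta> = fps_nth G j * of_real r ^ j * exp (\<i> * of_int (int j - int k) * of_real \<theta>)" for j \<theta>
  define g where "g = (\<lambda>\<theta>. eval_fps G (of_real r * exp (\<i> * of_real \<theta>)) * exp (- \<i> * of_nat k * of_real \<theta>))"
  have tj: "fps_nth G j * (of_real r * exp (\<i> * of_real \<theta>)) ^ j * exp (- \<i> * of_nat k * of_real \<theta>) = t j \<theta>" for j \<theta>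
  proof -
    have "\<i> * of_int (int j - int k) * of_real \<theta> = of_nat j * (\<i> * of_real \<theta>) + - \<i> * of_nat k * of_real \<theta>"
      by (simp add: algebra_simps)
    then show ?thesis
      unfolding t_def power_mult_distrib by (simp only: exp_of_nat_mult exp_add mult.assoc)
  qed
  have sums: "(\<lambda>j. t j \<theta>) sums g \<theta>" for \<theta>
    unfolding g_def tj[symmetric]
    by (intro sums_mult2 sums_eval_fps) (use r in \<open>simp add: norm_mult\<close>)
  have "summable (\<lambda>j. norm (fps_nth G j * of_real r ^ j))"
    by (rule norm_summable_fps) (use r in simp)
  then have "uniform_limit {-pi..pi} (\<lambda>n \<theta>. \<Sum>j<n. t j \<theta>) (\<lambda>\<theta>. \<Sum>j. t j \<theta>) sequentially"
    by (intro Weierstrass_m_test) (auto simp: t_def norm_mult)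
  then have lim: "uniform_limit {-pi..pi} (\<lambda>n \<theta>. \<Sum>j<n. t j \<theta>) g sequentially"
    using sums by (simp add: sums_iff)
  have cont: "continuous_on {-pi..pi} (\<lambda>\<theta>. \<Sum>j<n. t j \<theta>)" for n
    unfolding t_def by (intro continuous_intros)
  obtain I J where I: "\<And>n. ((\<lambda>\<theta>. \<Sum>j<n. t j \<theta>) has_integral I n) {-pi..pi}"
     and J: "(g has_integral J) {-pi..pi}" "I \<longlonglongrightarrow> J"
    using uniform_limit_integral[OF lim cont] by auto
  have "((\<lambda>\<theta>. \<Sum>j<n. t j \<theta>) has_integral (\<Sum>j<n. fps_nth G j * of_real r ^ j * (if int j - int k = 0 then 2 * pi else 0))) {-pi..pi}" for n
    unfolding t_def by (intro has_integral_sum has_integral_mult_right has_integral_exp_circle) auto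
  then have "I n = (\<Sum>j<n. fps_nth G j * of_real r ^ j * (if int j - int k = 0 then 2 * pi else 0))" for n
    using I has_integral_unique by blast
  also have "\<dots> n = (\<Sum>j<n. if j = k then 2 * pi * fps_nth G k * of_real r ^ k else 0)" for n
    by (intro sum.cong) auto
  finally have "\<forall>\<^sub>F n in sequentially. I n = 2 * pi * fps_nth G k * of_real r ^ k"
    by (intro eventually_mono[OF eventually_gt_at_top[of k]]) auto
  then have "I \<longlonglongrightarrow> 2 * pi * fps_nth G k * of_real r ^ k"
    by (rule tendsto_eventually)
  then have "J = 2 * pi * fps_nth G k * of_real r ^ k"
    using J(2) LIMSEQ_unique by blast
  then show ?thesis using J(1) unfolding g_def by simp
qed

lemma Re_eval_fps_circle_eq_arc_sum:
  assumes r: "0 \<le> r" "ereal r < fps_conv_radius h"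
  shows "Re (eval_fps (complex_fps h) (of_real r * exp (\<i> * of_real \<theta>))) - eval_fps h r = arc_sum (fps_nth h) r \<theta>"
proof -
  have "(\<lambda>k. fps_nth (complex_fps h) k * (of_real r * exp (\<i> * of_real \<theta>)) ^ k) sums
          eval_fps (complex_fps h) (of_real r * exp (\<i> * of_real \<theta>))"
    by (rule sums_eval_fps) (use r in \<open>simp add: norm_mult\<close>)
  then have "(\<lambda>k. Re (fps_nth (complex_fps h) k * (of_real r * exp (\<i> * of_real \<theta>)) ^ k)) sums
          Re (eval_fps (complex_fps h) (of_real r * exp (\<i> * of_real \<theta>)))"
    by (rule sums_Re)
  moreover have "Re (fps_nth (complex_fps h) k * (of_real r * exp (\<i> * of_real \<theta>)) ^ k) =
      fps_nth h k * r ^ k * cos (real k * \<theta>)" for k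
  proof -
    have "(of_real r * exp (\<i> * of_real \<theta>)) ^ k = of_real (r ^ k) * cis (real k * \<theta>)"
      unfolding cis_conv_exp[symmetric] power_mult_distrib Complex.DeMoivre by (simp only: of_real_power)
    moreover have "Re (of_real a * (of_real b * cis y)) = a * b * cos y" for a b y
      by simp
    ultimately show ?thesis by (simp only: complex_fps_nth)
  qed
  ultimately have "(\<lambda>k. fps_nth h k * r ^ k * cos (real k * \<theta>)) sums
          Re (eval_fps (complex_fps h) (of_real r * exp (\<i> * of_real \<theta>)))" by (simp only:)
  moreover have "(\<lambda>k. fps_nth h k * r ^ k) sums eval_fps h r"
    by (rule sums_eval_fps) (use r in simp)
  ultimately have "(\<lambda>k. fps_nth h k * r ^ k * cos (real k * \<theta>) - fps_nth h k * r ^ k) sums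
     (Re (eval_fps (complex_fps h) (of_real r * exp (\<i> * of_real \<theta>))) - eval_fps h r)"
    by (rule sums_diff)
  then show ?thesis
    unfolding arc_sum_def by (simp add: sums_iff algebra_simps)
qed

text \<open>
  The integral over the circle is split at \<open>\<plusminus>\<eta>\<close>. The substitution \<open>x = \<theta> / \<epsilon>\<close> turns
  the middle part into the Gaussian integral that is subtracted; the rest is bounded by its length times the maximum of the
  integrand.
\<close>

lemma coefficient_minus_saddle_integral_le:
  fixes f :: "real fps" and r \<eta> m :: real and n k :: nat
  defines "H \<equiv> eval_fps (complex_fps (log_fps f))"
  defines "\<epsilon> \<equiv> 1 / sqrt (real n * sigma_f f r)"
  assumes f0: "fps_nth f 0 = 1" and r: "0 < r" "ereal r < fps_conv_radius f" "ereal r < fps_conv_radius (log_fps f)"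
    and n: "n > 0" and k: "real k = real n * mu_f f r" and \<sigma>: "sigma_f f r > 0"
    and \<eta>: "0 < \<eta>" "\<eta> \<le> pi"
    and local: "\<And>z. norm z \<le> \<eta> \<Longrightarrow> H (of_real r * exp z) - H (of_real r) - of_real (mu_f f r) * z =
            of_real (sigma_f f r) * z\<^sup>2 / 2 * phi f r z"
    and minor: "\<And>\<theta>. \<eta> \<le> \<bar>\<theta>\<bar> \<Longrightarrow> \<bar>\<theta>\<bar> \<le> pi \<Longrightarrow> arc_sum (fps_nth (log_fps f)) r \<theta> \<le> - m"
  shows "norm (of_real (r ^ k * sqrt (2 * pi * real n * sigma_f f r) * (fps_nth (f ^ n) k / eval_fps f r ^ n))
     - (LINT x:{-\<eta>/\<epsilon>..\<eta>/\<epsilon>}|lborel. std_normal_density x *\<^sub>R exp (- ((of_real x)\<^sup>2 / 2) * (phi f r (\<i> * of_real (\<epsilon> * x)) - 1))))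
     \<le> sqrt (real n * sigma_f f r / (2 * pi)) * (2 * pi * exp (- real n * m))"
proof -
  define \<omega> where "\<omega> = real n * sigma_f f r"
  have \<omega>: "\<omega> > 0" using n \<sigma> by (simp add: \<omega>_def)
  have \<epsilon>: "\<epsilon> > 0" "\<epsilon>\<^sup>2 * \<omega> = 1"
    using \<omega> by (simp_all add: \<epsilon>_def \<omega>_def[symmetric] power_divide)
  define g where "g = (\<lambda>\<theta>. exp (of_nat n * (H (of_real r * exp (\<i> * of_real \<theta>)) - H (of_real r) - \<i> * of_real (mu_f f r * \<theta>))))"
  define a where "a = fps_nth (f ^ n) k"
  have Hr: "exp (H (of_real r)) = of_real (eval_fps f r)" "H (of_real r) = of_real (eval_fps (log_fps f) r)"
    using exp_eval_log_fps[OF f0, of "of_real r"] r by (simp_all add: H_def eval_complex_fps_of_real)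
  have fr: "eval_fps f r > 0"
    using exp_eval_log_fps_real[OF f0, of r, symmetric] r by simp
  have g_eq: "eval_fps (complex_fps (f ^ n)) (of_real r * exp (\<i> * of_real \<theta>)) * exp (- \<i> * of_nat k * of_real \<theta>)
       = of_real (eval_fps f r ^ n) * g \<theta>" for \<theta>
  proof -
    have "eval_fps (complex_fps (f ^ n)) (of_real r * exp (\<i> * of_real \<theta>)) = exp (H (of_real r * exp (\<i> * of_real \<theta>))) ^ n"
      using r unfolding complex_fps_power H_def
      by (subst eval_fps_power, simp add: norm_mult, subst exp_eval_log_fps[OF f0]) (simp_all add: norm_mult)
    also have "\<dots> * exp (- \<i> * of_nat k * of_real \<theta>) = exp (H (of_real r)) ^ n * g \<theta>"
    proof -
      have "complex_of_nat k = of_nat n * of_real (mu_f f r)"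
        using k by (metis of_real_mult of_real_of_nat_eq)
      then have "of_nat n * H (of_real r * exp (\<i> * of_real \<theta>)) + - \<i> * of_nat k * of_real \<theta> =
         of_nat n * H (of_real r) + of_nat n * (H (of_real r * exp (\<i> * of_real \<theta>)) - H (of_real r) - \<i> * of_real (mu_f f r * \<theta>))"
        by (simp add: algebra_simps)
      then show ?thesis
        unfolding g_def by (simp only: exp_of_nat_mult[symmetric] exp_add[symmetric])
    qed
    finally show ?thesis by (simp only: Hr(1) of_real_power)
  qed
  have "ereal r < fps_conv_radius (complex_fps (f ^ n))"
    using r(2) fps_conv_radius_power[of f n] by (simp add: less_le_trans)
  from has_integral_fps_coeff[OF less_imp_le[OF r(1)] this, of k]
  have "((\<lambda>\<theta>. of_real (eval_fps f r ^ n) * g \<theta>) has_integral of_real (2 * pi * a * r ^ k)) {-pi..pi}"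
    unfolding g_eq by (simp add: a_def)
  from has_integral_mult_right[OF this, of "1 / of_real (eval_fps f r ^ n)"]
  have g_int: "(g has_integral of_real (2 * pi * a * r ^ k / eval_fps f r ^ n)) {-pi..pi}"
    using fr by simp
  have contg: "continuous_on S g" for S
    unfolding g_def H_def
    by (intro continuous_intros continuous_on_compose2[OF continuous_on_eval_fps]) (use r in \<open>auto simp: norm_mult\<close>)
  have integrable: "g integrable_on {x..y}" for x y
    by (intro integrable_continuous_real contg)
  have norm_g: "norm (g \<theta>) \<le> exp (- real n * m)" if "\<eta> \<le> \<bar>\<theta>\<bar>" "\<bar>\<theta>\<bar> \<le> pi" for \<theta>
  proof -
    have "norm (g \<theta>) = exp (real n * arc_sum (fps_nth (log_fps f)) r \<theta>)"
      using r unfolding g_def Hr(2) by (simp add: H_def Re_eval_fps_circle_eq_arc_sum[symmetric])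
    also have "\<dots> \<le> exp (- real n * m)"
      using mult_left_mono[OF minor[OF that] of_nat_0_le_iff[of n]]
      by (simp only: exp_le_cancel_iff mult_minus_left mult_minus_right)
    finally show ?thesis .
  qed
  define I where "I x y = integral {x..y} g" for x y
  have "I (-pi) pi = I (-pi) (-\<eta>) + I (-\<eta>) \<eta> + I \<eta> pi"
    unfolding I_def using \<eta> integrable
    by (simp add: Henstock_Kurzweil_Integration.integral_combine)
  moreover have "norm (I (-pi) (-\<eta>)) \<le> exp (- real n * m) * (- \<eta> - - pi)"
    unfolding I_def using \<eta> by (intro integral_bound contg norm_g) auto
  moreover have "norm (I \<eta> pi) \<le> exp (- real n * m) * (pi - \<eta>)"
    unfolding I_def using \<eta> by (intro integral_bound contg norm_g) auto
  ultimately have "norm (I (-pi) pi - I (-\<eta>) \<eta>) \<le> exp (- real n * m) * (- \<eta> - - pi) + exp (- real n * m) * (pi - \<eta>)"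
    using norm_triangle_ineq[of "I (-pi) (-\<eta>)" "I \<eta> pi"] by (simp add: algebra_simps)
  also have "\<dots> = 2 * (pi - \<eta>) * exp (- real n * m)"
    by (simp add: algebra_simps)
  also have "\<dots> \<le> 2 * pi * exp (- real n * m)"
    using \<eta> by (intro mult_right_mono) auto
  finally have tails: "norm (I (-pi) pi - I (-\<eta>) \<eta>) \<le> 2 * pi * exp (- real n * m)" .
  have "I (-pi) pi = of_real (2 * pi * a * r ^ k / eval_fps f r ^ n)"
    unfolding I_def by (rule integral_unique[OF g_int])
  moreover have "sqrt (\<omega> / (2 * pi)) * (2 * pi) = sqrt (2 * pi * \<omega>)"
  proof -
    have "sqrt (\<omega> / (2 * pi)) * (2 * pi) = sqrt (\<omega> / (2 * pi)) * sqrt ((2 * pi)\<^sup>2)"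
      by (simp only: real_sqrt_abs) simp
    also have "\<dots> = sqrt (2 * pi * \<omega>)"
      by (simp only: real_sqrt_mult[symmetric]) (simp add: power2_eq_square field_simps)
    finally show ?thesis .
  qed
  ultimately have lhs: "of_real (sqrt (\<omega> / (2 * pi))) * I (-pi) pi =
      of_real (r ^ k * sqrt (2 * pi * real n * sigma_f f r) * (fps_nth (f ^ n) k / eval_fps f r ^ n))"
    by (simp add: a_def \<omega>_def mult_ac flip: of_real_mult)
  define S where "S = {-\<eta>/\<epsilon>..\<eta>/\<epsilon>}"
  define q where "q x = std_normal_density x *\<^sub>R exp (- ((of_real x)\<^sup>2 / 2) * (phi f r (\<i> * of_real (\<epsilon> * x)) - 1))" for x
  have q_eq: "q x = of_real (1 / sqrt (2 * pi)) * g (\<epsilon> * x)" if "x \<in> S" for x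
  proof -
    define z where "z = \<i> * complex_of_real (\<epsilon> * x)"
    have "norm z \<le> \<eta>"
      using that \<epsilon> by (auto simp: z_def S_def norm_mult abs_mult field_simps abs_le_iff)
    have "of_real \<omega> * z\<^sup>2 = - of_real (\<epsilon>\<^sup>2 * \<omega> * x\<^sup>2)"
      by (simp add: z_def power_mult_distrib)
    then have z2: "of_real \<omega> * z\<^sup>2 = - (of_real x)\<^sup>2"
      unfolding \<epsilon>(2) by simp
    from local[OF \<open>norm z \<le> \<eta>\<close>] have "of_nat n * (H (of_real r * exp z) - H (of_real r) - of_real (mu_f f r) * z) =
        of_nat n * (of_real (sigma_f f r) * z\<^sup>2 / 2 * phi f r z)" by simp
    also have "\<dots> = of_real \<omega> * z\<^sup>2 / 2 * phi f r z"
      by (simp add: \<omega>_def)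
    also have "\<dots> = - ((of_real x)\<^sup>2 / 2) * phi f r z"
      unfolding z2 by simp
    finally have "g (\<epsilon> * x) = exp (- ((of_real x)\<^sup>2 / 2) * phi f r z)"
      unfolding g_def z_def by (simp add: mult_ac)
    moreover have "q x = of_real (1 / sqrt (2 * pi)) * (exp (- ((of_real x)\<^sup>2 / 2)) * exp (- ((of_real x)\<^sup>2 / 2) * (phi f r z - 1)))"
      by (simp add: q_def z_def std_normal_density_def scaleR_conv_of_real exp_of_real[symmetric])
    moreover have "- ((of_real x)\<^sup>2 / 2) + - ((of_real x)\<^sup>2 / 2) * (phi f r z - 1) = - ((of_real x)\<^sup>2 / 2) * phi f r z"
      by (simp add: algebra_simps)
    ultimately show ?thesis
      by (simp only: exp_add[symmetric])
  qed
  have "(g has_integral I (-\<eta>) \<eta>) (cbox (-\<eta>) \<eta>)"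
    unfolding I_def using integrable by auto
  from has_integral_affinity[OF this, of \<epsilon> 0]
  have "((\<lambda>x. g (\<epsilon> * x)) has_integral of_real (1 / \<epsilon>) * I (-\<eta>) \<eta>) ((\<lambda>x. (1 / \<epsilon>) * x) ` {-\<eta>..\<eta>})"
    using \<epsilon> by (simp add: scaleR_conv_of_real)
  also have "(\<lambda>x. (1 / \<epsilon>) * x) ` {-\<eta>..\<eta>} = S"
    using \<epsilon> \<eta> image_mult_atLeastAtMost[of "1 / \<epsilon>" "-\<eta>" \<eta>] by (simp add: S_def)
  finally have "((\<lambda>x. of_real (1 / sqrt (2 * pi)) * g (\<epsilon> * x)) has_integral of_real (1 / sqrt (2 * pi)) * (of_real (1 / \<epsilon>) * I (-\<eta>) \<eta>)) S"
    by (rule has_integral_mult_right)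
  then have q_int: "(q has_integral of_real (1 / sqrt (2 * pi)) * (of_real (1 / \<epsilon>) * I (-\<eta>) \<eta>)) S"
    by (rule has_integral_eq[rotated]) (simp add: q_eq)
  have "continuous_on S q \<longleftrightarrow> continuous_on S (\<lambda>x. of_real (1 / sqrt (2 * pi)) * g (\<epsilon> * x))"
    by (intro continuous_on_cong) (auto simp: q_eq)
  then have "continuous_on S q"
    by (auto intro!: continuous_intros continuous_on_compose2[OF contg])
  then have "set_integrable lborel S q"
    unfolding S_def by (rule borel_integrable_atLeastAtMost')
  then have "(LINT x:S|lborel. q x) = of_real (1 / sqrt (2 * pi)) * (of_real (1 / \<epsilon>) * I (-\<eta>) \<eta>)"
    using q_int by (simp add: set_borel_integral_eq_integral integral_unique)
  also have "\<dots> = of_real (sqrt (\<omega> / (2 * pi))) * I (-\<eta>) \<eta>"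
    by (simp add: \<epsilon>_def \<omega>_def[symmetric] real_sqrt_divide flip: of_real_mult of_real_divide mult.assoc)
  finally have rhs: "(LINT x:S|lborel. q x) = of_real (sqrt (\<omega> / (2 * pi))) * I (-\<eta>) \<eta>" .
  have "norm (of_real (sqrt (\<omega> / (2 * pi))) * I (-pi) pi - (LINT x:S|lborel. q x)) =
        sqrt (\<omega> / (2 * pi)) * norm (I (-pi) pi - I (-\<eta>) \<eta>)"
    unfolding rhs right_diff_distrib[symmetric] norm_mult using \<omega> by simp
  also have "\<dots> \<le> sqrt (\<omega> / (2 * pi)) * (2 * pi * exp (- real n * m))"
    using tails \<omega> by (intro mult_left_mono) auto
  finally show ?thesis
    unfolding lhs by (simp add: q_def S_def \<omega>_def)
qed

section \<open>Estimates for small radii\<close>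

lemma summable_weighted_fps:
  fixes h :: "real fps"
  assumes \<rho>: "0 < \<rho>" "ereal \<rho> < fps_conv_radius h"
  shows "summable (\<lambda>k. \<bar>fps_nth h k\<bar> * (1 + (real k)\<^sup>2) * \<rho> ^ k)"
proof -
  have "fps_conv_radius h \<le> fps_conv_radius (fps_XD (fps_XD h))"
    by (rule order_trans[OF fps_conv_radius_XD fps_conv_radius_XD])
  then have "summable (\<lambda>k. norm (fps_nth h k * \<rho> ^ k) + norm (fps_nth (fps_XD (fps_XD h)) k * \<rho> ^ k))"
    using \<rho> by (intro summable_add norm_summable_fps) (auto intro: less_le_trans)
  moreover have "norm (fps_nth h k * \<rho> ^ k) + norm (fps_nth (fps_XD (fps_XD h)) k * \<rho> ^ k) =
      \<bar>fps_nth h k\<bar> * (1 + (real k)\<^sup>2) * \<rho> ^ k" for k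
    using \<rho> by (simp add: abs_mult power2_eq_square algebra_simps)
  ultimately show ?thesis by simp
qed

lemma eventually_at_right_0_less_conv_radius:
  assumes "R > (0 :: ereal)" "c > (0 :: real)"
  shows "\<forall>\<^sub>F r in at_right 0. ereal (r * c) < R"
proof -
  obtain x where x: "0 < ereal x" "ereal x < R"
    using ereal_dense2[OF assms(1)] by auto
  have "\<forall>\<^sub>F r in at_right 0. r < x / c"
    using x assms by (intro eventually_at_rightI[of 0 "x / c"]) auto
  then show ?thesis
  proof eventually_elim
    case (elim r)
    then have "ereal (r * c) < ereal x" using assms by (simp add: field_simps)
    then show ?case using x(2) by (rule less_trans)
  qed
qed

text \<open>
  All of \<open>h\<close>, \<open>\<mu>\<close> and \<open>\<sigma>\<close> have a leading term in \<open>r\<^sup>l\<close>, with coefficients \<open>1/l\<close>, \<open>1\<close> and \<open>l\<close>, and each is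
  comparable to it near \<open>0\<close>.
\<close>

lemma saddle_point_local_estimates:
  fixes f :: "real fps"
  assumes f0: "fps_nth f 0 = 1" and rad: "fps_conv_radius f > 0"
    and l: "l > 0" "\<forall>k. 0 < k \<longrightarrow> k < l \<longrightarrow> fps_nth f k = 0" "real l * fps_nth f l = 1"
  shows "\<exists>M\<ge>0. \<forall>\<^sub>F r in at_right 0.
     ereal r < fps_conv_radius f \<and> ereal r < fps_conv_radius (log_fps f) \<and>
     r ^ l / 2 \<le> mu_f f r \<and> mu_f f r \<le> 2 * r ^ l \<and>
     r ^ l / 2 \<le> sigma_f f r \<and> sigma_f f r \<le> 2 * real l * r ^ l \<and>
     phi f r holomorphic_on cball 0 1 \<and>
     (\<forall>z. norm z \<le> 1 \<longrightarrow> norm (phi f r z) \<le> M) \<and>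
     (\<forall>z. norm z \<le> 1 \<longrightarrow> eval_fps (complex_fps (log_fps f)) (of_real r * exp z)
          - eval_fps (complex_fps (log_fps f)) (of_real r) - of_real (mu_f f r) * z =
            of_real (sigma_f f r) * z\<^sup>2 / 2 * phi f r z)"
proof -
  define h where "h = log_fps f"
  have radh: "fps_conv_radius h > 0"
    unfolding h_def using f0 rad by (intro fps_conv_radius_log_fps_pos) auto
  have h_eq: "fps_nth h k = fps_nth f k" if "0 < k" "k \<le> l" for k
    unfolding h_def by (rule log_fps_nth_outside_subgroup[OF f0, of "\<lambda>k. k = 0" l]) (use l that in auto)
  have h_zero: "fps_nth h k = 0" if "k < l" for k
    using h_eq[of k] l(2)[rule_format, of k] that by (cases "k = 0") (auto simp: h_def)
  have h_l: "real l * fps_nth h l = 1"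
    using h_eq[of l] l by simp
  have radX: "fps_conv_radius (fps_XD h) > 0" "fps_conv_radius (fps_XD (fps_XD h)) > 0"
    using radh fps_conv_radius_XD[of h] fps_conv_radius_XD[of "fps_XD h"] by (auto intro: less_le_trans)
  define C where "C = norm (fps_nth (complex_fps h) l) + 1"
  have C: "C > 0" unfolding C_def by (smt (verit) norm_ge_zero)
  obtain d where d: "d > 0" "\<And>z. norm z < d \<Longrightarrow> norm (eval_fps (complex_fps h) z) \<le> C * norm z ^ l"
    unfolding C_def
    using norm_eval_fps_leading_bound[of "complex_fps h" l] radh h_zero l by auto
  define M where "M = 2 * (2 * C * exp 2 ^ l + 1) * 4"
  have mu: "\<forall>\<^sub>F r in at_right 0. 1 / 2 * r ^ l \<le> eval_fps (fps_XD h) r \<and> eval_fps (fps_XD h) r \<le> 2 * 1 * r ^ l"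
    using eval_fps_leading_bounds[OF radX(1), of l] h_zero h_l by simp
  have sigma: "\<forall>\<^sub>F r in at_right 0. real l / 2 * r ^ l \<le> eval_fps (fps_XD (fps_XD h)) r \<and> eval_fps (fps_XD (fps_XD h)) r \<le> 2 * real l * r ^ l"
    using eval_fps_leading_bounds[OF radX(2), of l] h_zero h_l l by simp
  have "((\<lambda>r. C * (r * exp 2) ^ l) \<longlongrightarrow> C * (0 * exp 2) ^ l) (at_right 0)"
    by (intro tendsto_intros)
  then have small: "\<forall>\<^sub>F r in at_right 0. C * (r * exp 2) ^ l < 1"
    by (rule order_tendstoD) (use l in \<open>simp add: power_0_left\<close>)
  have "((\<lambda>r. r * exp 2) \<longlongrightarrow> 0 * exp 2) (at_right (0::real))"
    by (intro tendsto_intros)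
  then have small_d: "\<forall>\<^sub>F r in at_right 0. r * exp 2 < d"
    by (rule order_tendstoD) (use d in simp)
  have "\<forall>\<^sub>F r in at_right 0.
     ereal r < fps_conv_radius f \<and> ereal r < fps_conv_radius (log_fps f) \<and>
     r ^ l / 2 \<le> mu_f f r \<and> mu_f f r \<le> 2 * r ^ l \<and>
     r ^ l / 2 \<le> sigma_f f r \<and> sigma_f f r \<le> 2 * real l * r ^ l \<and>
     phi f r holomorphic_on cball 0 1 \<and>
     (\<forall>z. norm z \<le> 1 \<longrightarrow> norm (phi f r z) \<le> M) \<and>
     (\<forall>z. norm z \<le> 1 \<longrightarrow> eval_fps (complex_fps (log_fps f)) (of_real r * exp z)
          - eval_fps (complex_fps (log_fps f)) (of_real r) - of_real (mu_f f r) * z =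
            of_real (sigma_f f r) * z\<^sup>2 / 2 * phi f r z)"
    using mu sigma small small_d eventually_at_right_0_less_conv_radius[OF rad exp_gt_zero, of 2]
      eventually_at_right_0_less_conv_radius[OF radh exp_gt_zero, of 2] eventually_at_right_less[of 0]
  proof eventually_elim
    case (elim r)
    have rexp: "ereal \<bar>r\<bar> \<le> ereal (r * exp 2)"
      using elim by simp
    have rads: "ereal \<bar>r\<bar> < fps_conv_radius f" "ereal \<bar>r\<bar> < fps_conv_radius (log_fps f)"
      using le_less_trans[OF rexp elim(5)] le_less_trans[OF rexp elim(6)] by (simp_all only: h_def)
    have mu_eq: "mu_f f r = eval_fps (fps_XD h) r" and sigma_eq: "sigma_f f r = eval_fps (fps_XD (fps_XD h)) r"
      unfolding h_def by (rule mu_f_eq[OF f0 rads], rule sigma_f_eq[OF f0 rads])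
    have rl: "r ^ l > 0" using elim by simp
    have "1 / 2 * r ^ l \<le> real l / 2 * r ^ l"
      using l rl by (intro mult_right_mono) auto
    then have bounds: "r ^ l / 2 \<le> mu_f f r" "mu_f f r \<le> 2 * r ^ l" "r ^ l / 2 \<le> sigma_f f r" "sigma_f f r \<le> 2 * real l * r ^ l"
      using elim(1,2) unfolding mu_eq sigma_eq by linarith+
    have bound: "norm (eval_fps (complex_fps (log_fps f)) w) \<le> C * norm w ^ l" if "norm w \<le> r * exp 2" for w
      using d(2)[of w] that elim by (simp add: h_def)
    have pos: "sigma_f f r > 0" "mu_f f r \<ge> 0" "mu_f f r \<le> 4 * sigma_f f r" "r ^ l \<le> 4 * sigma_f f r"
      using bounds rl by linarith+
    have "ereal (r * exp 2) < fps_conv_radius f" "ereal (r * exp 2) < fps_conv_radius (log_fps f)" "0 \<le> C" "C * (r * exp 2) ^ l \<le> 1"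
      using elim C by (auto simp: h_def)
    note phi = phi_holomorphic_bounded[OF f0 elim(7) this(1,2) bound this(3,4) pos, folded M_def]
    show ?case
      using bounds rads elim phi by auto
  qed
  moreover have "M \<ge> 0" using C by (simp add: M_def)
  ultimately show ?thesis by blast
qed

text \<open>
  If \<open>l\<close> divided \<open>jk\<close> for all \<open>k\<close> in \<open>L(f)\<close>, it would divide \<open>j\<close> times their greatest common divisor,
  that is \<open>j\<close> itself. So the set of which \<open>l\<^sub>j\<close> is the minimum is not empty.
\<close>

lemma l_idx_props:
  assumes gcd: "Gcd (L_set f) = 1" and j: "1 \<le> j" "j \<le> min_L f div 2" and l: "min_L f > 1"
  shows "l_idx f j \<in> L_set f" "\<not> min_L f dvd j * l_idx f j" "min_L f < l_idx f j"
    "\<And>k. k < l_idx f j \<Longrightarrow> k \<in> L_set f \<Longrightarrow> min_L f dvd j * k"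
proof -
  have "\<exists>k. k \<in> L_set f \<and> \<not> min_L f dvd j * k"
  proof (rule ccontr)
    assume "\<not> ?thesis"
    then have "min_L f dvd Gcd ((*) j ` L_set f)"
      by (intro Gcd_greatest) auto
    then have "min_L f dvd j"
      by (simp add: Gcd_mult gcd)
    then show False using j l by (auto dest: dvd_imp_le)
  qed
  from LeastI_ex[OF this] show idx: "l_idx f j \<in> L_set f" "\<not> min_L f dvd j * l_idx f j"
    by (auto simp: l_idx_def)
  have "min_L f \<le> l_idx f j"
    unfolding min_L_def by (rule Least_le[of "\<lambda>k. k \<in> L_set f", OF idx(1)])
  moreover have "min_L f \<noteq> l_idx f j" using idx(2) by auto
  ultimately show "min_L f < l_idx f j" by simp
  show "min_L f dvd j * k" if "k < l_idx f j" "k \<in> L_set f" for k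
    using not_less_Least[of k "\<lambda>k. k \<in> L_set f \<and> \<not> min_L f dvd j * k"] that by (auto simp: l_idx_def)
qed

text \<open>
  Strong positivity at the angles \<open>2\<pi>j/l\<close> says that the cosine sum of \<open>log f\<close> is negative there, which
  makes the coefficient with index \<open>l\<^sub>j\<close> positive.
\<close>

lemma saddle_minor_arc_estimate:
  fixes f :: "real fps"
  assumes f0: "fps_nth f 0 = 1" and rad: "fps_conv_radius f > 0"
    and strongly_pos: "\<forall>\<^sub>F s in at_right 0. strongly_positive_at f s"
    and gcd: "Gcd (L_set f) = 1" and l: "min_L f > 1"
    and zero: "\<forall>k. 0 < k \<longrightarrow> k < min_L f \<longrightarrow> fps_nth f k = 0" and pos: "fps_nth f (min_L f) > 0"
    and L: "min_L f \<le> L" "\<forall>j. 1 \<le> j \<longrightarrow> j \<le> min_L f div 2 \<longrightarrow> l_idx f j \<le> L"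
    and \<eta>: "\<eta> > 0"
  shows "\<exists>c>0. \<forall>\<^sub>F r in at_right 0. \<forall>\<theta>. \<eta> \<le> \<bar>\<theta>\<bar> \<longrightarrow> \<bar>\<theta>\<bar> \<le> pi \<longrightarrow> arc_sum (fps_nth (log_fps f)) r \<theta> \<le> - (c * r ^ L)"
proof -
  define l where "l = min_L f"
  define b where "b = fps_nth (log_fps f)"
  have radh: "fps_conv_radius (log_fps f) > 0"
    using f0 rad by (intro fps_conv_radius_log_fps_pos) auto
  obtain \<rho> where \<rho>: "0 < \<rho>" "ereal \<rho> < fps_conv_radius (log_fps f)"
    using ereal_dense2[OF radh] by auto
  have sum: "summable (\<lambda>k. \<bar>b k\<bar> * (1 + (real k)\<^sup>2) * \<rho> ^ k)"
    unfolding b_def by (rule summable_weighted_fps[OF \<rho>])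
  have b_eq: "b k = fps_nth f k" if "0 < k" "k \<le> l" for k
    unfolding b_def by (rule log_fps_nth_outside_subgroup[OF f0, of "\<lambda>k. k = 0" l]) (use zero that in \<open>auto simp: l_def\<close>)
  have Lj: "\<exists>L'. l < L' \<and> L' \<le> L \<and> \<not> l dvd j * L' \<and> b L' > 0 \<and> (\<forall>k<L'. \<not> l dvd j * k \<longrightarrow> b k = 0)"
    if j: "1 \<le> j" "j \<le> l div 2" for j
  proof (intro exI conjI allI impI)
    note idx = l_idx_props[OF gcd j[unfolded l_def] \<open>min_L f > 1\<close>, folded l_def]
    show "l < l_idx f j" "l_idx f j \<le> L" "\<not> l dvd j * l_idx f j"
      using idx L(2) j by (auto simp: l_def)
    have outside: "b k = fps_nth f k" if "k \<le> l_idx f j" "\<not> l dvd j * k" for k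
      unfolding b_def
    proof (rule log_fps_nth_outside_subgroup[OF f0, of "\<lambda>k. l dvd j * k" "l_idx f j"])
      show "fps_nth f k = 0" if "0 < k" "k < l_idx f j" "\<not> l dvd j * k" for k
        using idx(4)[of k] that by (auto simp: L_set_def)
    qed (use that in \<open>auto simp: distrib_left intro: gr0I\<close>)
    show zero': "b k = 0" if "k < l_idx f j" "\<not> l dvd j * k" for k
    proof -
      have "k \<noteq> 0" using that by (intro notI) auto
      then show ?thesis
        using outside[of k] idx(4)[of k] that by (auto simp: L_set_def)
    qed
    have nz: "b (l_idx f j) \<noteq> 0"
      using outside[of "l_idx f j"] idx(1,2) by (auto simp: L_set_def)
    have \<theta>: "0 < 2 * pi * real j / real l" "2 * pi * real j / real l < 2 * pi"
      using j by (auto simp: field_simps)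
    have "\<forall>\<^sub>F r in at_right 0. arc_sum b r (2 * pi * real j / real l) < 0"
      using strongly_pos eventually_at_right_0_less_conv_radius[OF rad zero_less_one]
        eventually_at_right_0_less_conv_radius[OF radh zero_less_one]
    proof eventually_elim
      case (elim r)
      define w where "w = complex_of_real r * exp (\<i> * complex_of_real (2 * pi * real j / real l))"
      have r: "r > 0" using elim by (simp add: strongly_positive_at_def)
      have norm_w: "norm w = r" using r by (simp add: w_def norm_mult)
      have "norm (eval_fps (complex_fps f) w) < eval_fps f r"
        using elim(1) \<theta> unfolding strongly_positive_at_def w_def by blast
      moreover have "eval_fps (complex_fps f) w = exp (eval_fps (complex_fps (log_fps f)) w)"
        by (rule exp_eval_log_fps[OF f0, symmetric]) (use elim norm_w in simp_all)
      moreover have "eval_fps f r = exp (eval_fps (log_fps f) r)"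
        by (rule exp_eval_log_fps_real[OF f0, symmetric]) (use elim r in simp_all)
      ultimately have "Re (eval_fps (complex_fps (log_fps f)) w) < eval_fps (log_fps f) r"
        by simp
      moreover have "Re (eval_fps (complex_fps (log_fps f)) w) - eval_fps (log_fps f) r = arc_sum b r (2 * pi * real j / real l)"
        unfolding b_def w_def by (rule Re_eval_fps_circle_eq_arc_sum) (use elim r in simp_all)
      ultimately show ?case by simp
    qed
    then show "b (l_idx f j) > 0"
      using l idx(2) nz zero' by (intro arc_sum_leading_positive[OF sum \<rho>(1), of l j]) (auto simp: l_def)
  qed
  have "\<exists>c>0. \<exists>r0>0. \<forall>r \<theta>. 0 < r \<longrightarrow> r < r0 \<longrightarrow> \<eta> \<le> \<bar>\<theta>\<bar> \<longrightarrow> \<bar>\<theta>\<bar> \<le> pi \<longrightarrow> arc_sum b r \<theta> \<le> - c * r ^ L"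
  proof (rule minor_arc_bound[OF sum \<rho>(1), of l])
    show "0 < l" "l \<le> L" using l L by (auto simp: l_def)
    show "b k = 0" if "0 < k" "k < l" for k
      using b_eq[of k] zero[rule_format, of k] that by (simp add: l_def)
    show "b l > 0" using b_eq[of l] pos l by (simp add: l_def)
  qed (use Lj \<eta> in auto)
  then obtain c r0 where c: "c > 0" "r0 > 0" "\<And>r \<theta>. 0 < r \<Longrightarrow> r < r0 \<Longrightarrow> \<eta> \<le> \<bar>\<theta>\<bar> \<Longrightarrow> \<bar>\<theta>\<bar> \<le> pi \<Longrightarrow> arc_sum b r \<theta> \<le> - c * r ^ L"
    by blast
  have "\<forall>\<^sub>F r in at_right 0. \<forall>\<theta>. \<eta> \<le> \<bar>\<theta>\<bar> \<longrightarrow> \<bar>\<theta>\<bar> \<le> pi \<longrightarrow> arc_sum b r \<theta> \<le> - (c * r ^ L)"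
    unfolding eventually_at_right_field using c by (intro exI[of _ r0]) auto
  then show ?thesis using c(1) unfolding b_def by blast
qed

lemma powr_times_exp_neg_powr_bounded:
  assumes "a > 0" "e > 0"
  shows "\<exists>B. \<forall>\<^sub>F n in sequentially. real n powr p * exp (- (a * real n powr e)) \<le> B"
proof -
  have "(\<lambda>n. real n powr p * exp (- (a * real n powr e))) \<longlonglongrightarrow> 0"
    using assms by real_asymp
  then have "\<forall>\<^sub>F n in sequentially. real n powr p * exp (- (a * real n powr e)) < 1"
    by (rule order_tendstoD) simp
  then show ?thesis by (intro exI[of _ 1]) (auto elim: eventually_mono)
qed

section \<open>The asymptotic expansion\<close>

text \<open>
  The relation \<open>k = n \<mu>\<close> converts powers of \<open>1 / (n \<sigma>)\<close> into powers of \<open>\<mu> / (\<sigma> k)\<close>.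
\<close>

lemma saddle_coeff_phi_eq_c_coeff:
  assumes n: "n > 0" and k: "real k = real n * mu_f f r" and pos: "mu_f f r > 0" "sigma_f f r > 0"
  shows "saddle_coeff (\<lambda>z. phi f r z - 1) \<nu> * of_real (1 / sqrt (real n * sigma_f f r)) ^ (2 * \<nu>) =
     c_coeff f r \<nu> / of_nat k ^ \<nu>"
proof -
  define D where "D = (deriv ^^ (2 * \<nu>)) (\<lambda>z. phi f r z powr (- of_nat \<nu> - 1 / 2)) 0"
  have "(1 / sqrt (real n * sigma_f f r)) ^ (2 * \<nu>) = (1 / (real n * sigma_f f r)) ^ \<nu>"
    using pos by (simp add: power_mult power_divide)
  then have "complex_of_real ((1 / sqrt (real n * sigma_f f r)) ^ (2 * \<nu>)) = of_real ((1 / (real n * sigma_f f r)) ^ \<nu>)"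
    by (simp only:)
  then have \<epsilon>: "complex_of_real (1 / sqrt (real n * sigma_f f r)) ^ (2 * \<nu>) = 1 / (of_nat n * of_real (sigma_f f r)) ^ \<nu>"
    by (simp add: power_divide power_mult_distrib)
  have k': "complex_of_nat k = of_nat n * of_real (mu_f f r)"
    using k by (metis of_real_mult of_real_of_nat_eq)
  show ?thesis
    unfolding \<epsilon> k' saddle_coeff_def c_coeff_def using n pos
    by (simp add: D_def[symmetric] power_mult_distrib field_simps)
qed

text \<open>
  The intermediate value theorem yields a solution of \<open>k = n \<mu>(s)\<close> in every interval \<open>(0, e)\<close> once
  \<open>k / n\<close> is small enough, and uniqueness forces it to be \<open>r n\<close>.
\<close>

lemma saddle_point_tendsto_0:
  fixes f :: "real fps" and k :: "nat \<Rightarrow> nat" and r :: "nat \<Rightarrow> real"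
  assumes f0: "fps_nth f 0 = 1" and rad: "fps_conv_radius f > 0"
    and l: "l > 0" "\<forall>k. 0 < k \<longrightarrow> k < l \<longrightarrow> fps_nth f k = 0" "real l * fps_nth f l = 1"
    and \<rho>: "0 < \<rho>"
    and k: "\<forall>n>0. k n > 0" "(\<lambda>n. real (k n) / real n) \<longlonglongrightarrow> 0"
    and r: "\<forall>\<^sub>F n in sequentially. 0 < r n \<and>
          (\<forall>s. 0 < s \<and> s < \<rho> \<and> real (k n) = real n * mu_f f s \<longrightarrow> s = r n)"
  shows "filterlim r (at_right 0) sequentially"
proof -
  have "\<forall>\<^sub>F r in at_right 0. ereal r < fps_conv_radius f \<and> ereal r < fps_conv_radius (log_fps f) \<and> r ^ l / 2 \<le> mu_f f r"
    using saddle_point_local_estimates[OF f0 rad l] by (elim exE conjE, elim eventually_mono) blast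
  then obtain b where b: "b > 0" "\<And>s. 0 < s \<Longrightarrow> s < b \<Longrightarrow> ereal s < fps_conv_radius f \<and> ereal s < fps_conv_radius (log_fps f) \<and> s ^ l / 2 \<le> mu_f f s"
    unfolding eventually_at_right_field by blast
  have small: "\<forall>\<^sub>F n in sequentially. r n < e" if e: "e > 0" for e
  proof -
    define s where "s = min b (min e \<rho>) / 2"
    define g where "g = eval_fps (fps_XD (log_fps f))"
    have s: "0 < s" "s < b" "s < e" "s < \<rho>"
      using b e \<rho> by (auto simp: s_def)
    have mu: "mu_f f y = g y" if "0 < y" "y \<le> s" for y
      unfolding g_def using b(2)[of y] that s by (intro mu_f_eq[OF f0]) auto
    have "continuous_on {0..s} g"
      unfolding g_def
    proof (rule continuous_on_subset[OF continuous_on_eval_fps], rule subsetI)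
      fix y assume "y \<in> {0..s}"
      then have "ereal (norm y) \<le> ereal s" by simp
      also have "\<dots> < fps_conv_radius (log_fps f)" using b(2)[of s] s by simp
      also have "\<dots> \<le> fps_conv_radius (fps_XD (log_fps f))" by (rule fps_conv_radius_XD)
      finally show "y \<in> eball 0 (fps_conv_radius (fps_XD (log_fps f)))" by simp
    qed
    moreover have "g 0 = 0" by (simp add: g_def eval_fps_at_0)
    ultimately have ivt: "\<exists>y. 0 \<le> y \<and> y \<le> s \<and> g y = v" if "0 \<le> v" "v \<le> g s" for v
      using IVT'[of g 0 v s] that s by auto
    have "s ^ l / 2 > 0" using s by simp
    then have "mu_f f s > 0" using b(2)[of s] s by linarith
    then have "\<forall>\<^sub>F n in sequentially. real (k n) / real n < mu_f f s"
      by (rule order_tendstoD(2)[OF k(2)])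
    then show ?thesis
      using r eventually_gt_at_top[of 0]
    proof eventually_elim
      case (elim n)
      then obtain y where y: "0 \<le> y" "y \<le> s" "g y = real (k n) / real n"
        using ivt[of "real (k n) / real n"] mu[of s] s by auto
      have "g y > 0" using y k(1) elim by simp
      then have "y \<noteq> 0" using \<open>g 0 = 0\<close> by auto
      then have "y > 0" using y by simp
      moreover have "real (k n) = real n * mu_f f y"
        using y mu[OF \<open>y > 0\<close>] elim by simp
      ultimately have "y = r n" using elim y s by auto
      then show ?case using y s by simp
    qed
  qed
  have pos: "\<forall>\<^sub>F n in sequentially. 0 < r n"
    using r by eventually_elim simp
  have "r \<longlonglongrightarrow> 0"
  proof (rule order_tendstoI)
    show "\<forall>\<^sub>F n in sequentially. a < r n" if "a < 0" for a
      using pos by eventually_elim (use that in simp)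
  qed (rule small)
  then show ?thesis
    using pos by (rule tendsto_imp_filterlim_at_right)
qed

theorem theorem1:
  fixes f :: "real fps" and \<delta> \<rho> :: real and k :: "nat \<Rightarrow> nat" and r :: "nat \<Rightarrow> real"
  assumes nonconst: "\<forall>c. f \<noteq> fps_const c"
    and radius: "fps_conv_radius f > 0"
    and f0: "fps_nth f 0 = 1"
    and strongly_pos: "\<forall>\<^sub>F s in at_right 0. strongly_positive_at f s"
    and gcd_L: "Gcd (L_set f) = 1"
    and l_gt_1: "min_L f > 1"
    and l_coeff: "real (min_L f) * fps_nth f (min_L f) = 1"
    and delta: "eps0 f < \<delta>" "\<delta> < 1"
    and k_pos: "\<forall>n>0. k n > 0"
    and k_theta: "(\<lambda>n. real (k n)) \<in> \<Theta>(\<lambda>n. real n powr \<delta>)"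
    and rho: "0 < \<rho>" "ereal \<rho> \<le> fps_conv_radius f"
    and r_saddle: "\<forall>\<^sub>F n in sequentially.
          0 < r n \<and> r n < \<rho> \<and> real (k n) = real n * mu_f f (r n) \<and>
          (\<forall>s. 0 < s \<and> s < \<rho> \<and> real (k n) = real n * mu_f f s \<longrightarrow> s = r n)"
  shows "\<forall>N. (\<lambda>n. complex_of_real
               (r n ^ k n * sqrt (2 * pi * real n * sigma_f f (r n)) *
                (fps_nth (f ^ n) (k n) / eval_fps f (r n) ^ n))
             - (1 + (\<Sum>\<nu> = 1..N. c_coeff f (r n) \<nu> / of_nat (k n) ^ \<nu>)))
           \<in> O(\<lambda>n. 1 / of_nat (k n) ^ (N + 1))"
proof
  fix N :: nat
  define l where "l = min_L f"
  have l0: "l > 0" using l_gt_1 by (simp add: l_def)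
  have zero: "\<forall>j. 0 < j \<longrightarrow> j < l \<longrightarrow> fps_nth f j = 0"
    using not_less_Least[of _ "\<lambda>j. j \<in> L_set f"] by (auto simp: l_def min_L_def L_set_def)
  have fl: "real l * fps_nth f l = 1" using l_coeff by (simp add: l_def)
  have "0 < real l * fps_nth f l" unfolding fl by simp
  then have fl_pos: "fps_nth f l > 0"
    by (rule zero_less_mult_pos) (use l0 in simp)
  define J where "J = {1..l div 2}"
  have J: "finite J" "J \<noteq> {}" using l_gt_1 by (auto simp: J_def l_def)
  define L where "L = Max (l_idx f ` J)"
  have "L \<in> l_idx f ` J" unfolding L_def using J by (intro Max_in) auto
  then obtain j0 where j0: "j0 \<in> J" "L = l_idx f j0" by blast
  have L_ge: "l_idx f j \<le> L" if "j \<in> J" for j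
    unfolding L_def using J that by (intro Max_ge) auto
  have lL: "l < L"
    using l_idx_props(3)[OF gcd_L _ _ l_gt_1, of j0] j0 by (simp add: J_def l_def)
  have "1 - real l / real L \<le> eps0 f"
    unfolding eps0_def j0(2) l_def[symmetric] J_def[symmetric] using J j0 by (intro Max_ge) auto
  then have \<delta>_L: "1 - real l / real L < \<delta>" using delta by simp
  have "0 < 1 - real l / real L" using lL by simp
  then have \<delta>0: "0 < \<delta>" using \<delta>_L by simp
  \<comment> \<open>The hypothesis on \<open>\<delta>\<close> is exactly that this exponent, that of \<open>n\<close> in \<open>n r\<^sup>L\<close>, is positive.\<close>
  define \<kappa> where "\<kappa> = 1 - (1 - \<delta>) * (real L / real l)"
  have \<kappa>: "\<kappa> > 0"
    using \<delta>_L lL l0 by (simp add: \<kappa>_def field_simps)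

  obtain M where M: "M \<ge> 0" and local: "\<forall>\<^sub>F r in at_right 0.
     ereal r < fps_conv_radius f \<and> ereal r < fps_conv_radius (log_fps f) \<and>
     r ^ l / 2 \<le> mu_f f r \<and> mu_f f r \<le> 2 * r ^ l \<and>
     r ^ l / 2 \<le> sigma_f f r \<and> sigma_f f r \<le> 2 * real l * r ^ l \<and>
     phi f r holomorphic_on cball 0 1 \<and>
     (\<forall>z. norm z \<le> 1 \<longrightarrow> norm (phi f r z) \<le> M) \<and>
     (\<forall>z. norm z \<le> 1 \<longrightarrow> eval_fps (complex_fps (log_fps f)) (of_real r * exp z)
          - eval_fps (complex_fps (log_fps f)) (of_real r) - of_real (mu_f f r) * z =
            of_real (sigma_f f r) * z\<^sup>2 / 2 * phi f r z)"
    using saddle_point_local_estimates[OF f0 radius l0 zero fl] by blast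
  \<comment> \<open>The Schwarz-type bound \<open>2 (M + 1) \<bar>z\<bar>\<close> for \<open>\<phi> - 1\<close> must not exceed one half on the disc of this radius.\<close>
  define \<eta> where "\<eta> = 1 / (4 * (M + 1))"
  have \<eta>: "0 < \<eta>" "\<eta> \<le> 1 / 2" "2 * (M + 1) * \<eta> \<le> 1 / 2"
    using M by (auto simp: \<eta>_def field_simps)
  then have \<eta>_le: "\<eta> \<le> 1" "\<eta> \<le> pi"
    using pi_gt3 by linarith+
  obtain C where C: "\<And>\<psi> \<epsilon>. \<psi> holomorphic_on cball 0 1 \<Longrightarrow> (\<forall>z. norm z \<le> 1 \<longrightarrow> norm (\<psi> z) \<le> M + 1) \<Longrightarrow>
     \<psi> 0 = 0 \<Longrightarrow> (\<forall>z. norm z \<le> \<eta> \<longrightarrow> norm (\<psi> z) \<le> 1 / 2) \<Longrightarrow> 0 < \<epsilon> \<Longrightarrow> \<epsilon> \<le> 1 \<Longrightarrow>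
     norm ((LINT x:{-\<eta>/\<epsilon>..\<eta>/\<epsilon>}|lborel. std_normal_density x *\<^sub>R exp (- ((of_real x)\<^sup>2 / 2) * \<psi> (\<i> * of_real (\<epsilon> * x))))
        - (\<Sum>\<nu>\<le>N. saddle_coeff \<psi> \<nu> * of_real \<epsilon> ^ (2 * \<nu>))) \<le> C * \<epsilon> ^ (2 * N + 2)"
    using gaussian_saddle_expansion[OF zero_less_one \<eta>(1,2), of "M + 1" N] by blast
  have L_ge': "\<forall>j. 1 \<le> j \<longrightarrow> j \<le> min_L f div 2 \<longrightarrow> l_idx f j \<le> L"
    using L_ge by (simp add: J_def l_def)
  obtain c where c: "c > 0" and minor: "\<forall>\<^sub>F r in at_right 0. \<forall>\<theta>. \<eta> \<le> \<bar>\<theta>\<bar> \<longrightarrow> \<bar>\<theta>\<bar> \<le> pi \<longrightarrow>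
      arc_sum (fps_nth (log_fps f)) r \<theta> \<le> - (c * r ^ L)"
    using saddle_minor_arc_estimate[OF f0 radius strongly_pos gcd_L l_gt_1 zero[unfolded l_def]
        fl_pos[unfolded l_def] less_imp_le[OF lL[unfolded l_def]] L_ge' \<eta>(1)] by blast

  obtain c1 where c1: "c1 > 0" "\<forall>\<^sub>F n in sequentially. c1 * real n powr \<delta> \<le> real (k n)"
    using k_theta unfolding bigtheta_def bigomega_iff_bigo by (auto elim!: landau_o.bigE simp: field_simps)
  obtain c2 where c2: "c2 > 0" "\<forall>\<^sub>F n in sequentially. real (k n) \<le> c2 * real n powr \<delta>"
    using k_theta unfolding bigtheta_def by (auto elim!: landau_o.bigE)
  have k_over_n: "(\<lambda>n. real (k n) / real n) \<longlonglongrightarrow> 0"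
  proof (rule tendsto_sandwich[where f = "\<lambda>_. 0" and h = "\<lambda>n. c2 * real n powr \<delta> / real n"])
    show "\<forall>\<^sub>F n in sequentially. real (k n) / real n \<le> c2 * real n powr \<delta> / real n"
      using c2(2) by eventually_elim (intro divide_right_mono, auto)
    show "(\<lambda>n. c2 * real n powr \<delta> / real n) \<longlonglongrightarrow> 0"
      using c2(1) delta \<delta>0 by real_asymp
  qed auto
  have k_large: "\<forall>\<^sub>F n in sequentially. real (k n) \<ge> 4"
  proof -
    have "filterlim (\<lambda>n. c1 * real n powr \<delta>) at_top sequentially"
      using c1(1) \<delta>0 by real_asymp
    then have "\<forall>\<^sub>F n in sequentially. c1 * real n powr \<delta> \<ge> 4"
      by (simp add: filterlim_at_top)
    then show ?thesis using c1(2) by eventually_elim simp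
  qed
  have r_lim: "filterlim r (at_right 0) sequentially"
    using r_saddle by (intro saddle_point_tendsto_0[OF f0 radius l0 zero fl rho(1) k_pos k_over_n])
      (auto elim: eventually_mono)
  \<comment> \<open>Chosen so that \<open>n c r\<^sup>L\<close> is at least \<open>a\<close> times the power of \<open>n\<close> with exponent \<open>\<kappa>\<close>.\<close>
  define a where "a = c * (c1 / 2) powr (real L / real l)"
  have a: "a > 0" using c c1 by (simp add: a_def)
  obtain B where B: "\<forall>\<^sub>F n in sequentially. real n powr (\<delta> * real (N + 2)) * exp (- (a * real n powr \<kappa>)) \<le> B"
    using powr_times_exp_neg_powr_bounded[OF a \<kappa>] by blast
  have main: "\<forall>\<^sub>F n in sequentially. norm (complex_of_real
               (r n ^ k n * sqrt (2 * pi * real n * sigma_f f (r n)) *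
                (fps_nth (f ^ n) (k n) / eval_fps f (r n) ^ n))
             - (1 + (\<Sum>\<nu> = 1..N. c_coeff f (r n) \<nu> / of_nat (k n) ^ \<nu>))) \<le>
             (\<bar>C\<bar> * 4 ^ (N + 1) + 8 * pi * real l * c2 ^ (N + 2) * B) * norm (1 / complex_of_nat (k n) ^ (N + 1))"
    using eventually_compose_filterlim[OF local r_lim] eventually_compose_filterlim[OF minor r_lim]
      r_saddle c1(2) c2(2) k_large B eventually_gt_at_top[of 0]
  proof eventually_elim
    case (elim n)
    define s where "s = r n"
    define K where "K = real (k n)"
    define A where "A = complex_of_real (r n ^ k n * sqrt (2 * pi * real n * sigma_f f (r n)) *
                (fps_nth (f ^ n) (k n) / eval_fps f (r n) ^ n))"
    define \<epsilon> where "\<epsilon> = 1 / sqrt (real n * sigma_f f s)"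
    define \<psi> where "\<psi> = (\<lambda>z. phi f s z - 1)"
    define G where "G = (LINT x:{-\<eta>/\<epsilon>..\<eta>/\<epsilon>}|lborel. std_normal_density x *\<^sub>R exp (- ((of_real x)\<^sup>2 / 2) * \<psi> (\<i> * of_real (\<epsilon> * x))))"
    have n: "n > 0" and s: "s > 0" and K: "K = real n * mu_f f s" "K \<ge> 4"
      using elim by (auto simp: s_def K_def)
    have sl: "s ^ l > 0" using s by simp
    have rads: "ereal s < fps_conv_radius f" "ereal s < fps_conv_radius (log_fps f)"
      and mu: "s ^ l / 2 \<le> mu_f f s" "mu_f f s \<le> 2 * s ^ l"
      and sigma: "s ^ l / 2 \<le> sigma_f f s" "sigma_f f s \<le> 2 * real l * s ^ l"
      and phi_holo: "phi f s holomorphic_on cball 0 1"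
      and phi_bd: "\<And>z. norm z \<le> 1 \<Longrightarrow> norm (phi f s z) \<le> M"
      and phi_eq: "\<And>z. norm z \<le> 1 \<Longrightarrow> eval_fps (complex_fps (log_fps f)) (of_real s * exp z)
          - eval_fps (complex_fps (log_fps f)) (of_real s) - of_real (mu_f f s) * z =
            of_real (sigma_f f s) * z\<^sup>2 / 2 * phi f s z"
      using elim(1)[folded s_def] by blast+
    have pos: "mu_f f s > 0" "sigma_f f s > 0"
      using mu sigma sl by linarith+
    have "real n * (s ^ l / 2) \<le> K" "K \<le> real n * (2 * s ^ l)"
      unfolding K(1) by (intro mult_left_mono mu, simp)+
    then have K_bounds: "real n * s ^ l \<le> 2 * K" "K \<le> 2 * (real n * s ^ l)"
      by (simp_all add: mult_ac)
    define \<omega> where "\<omega> = real n * sigma_f f s"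
    have "real n * (s ^ l / 2) \<le> \<omega>" "\<omega> \<le> real n * (2 * real l * s ^ l)"
      unfolding \<omega>_def by (intro mult_left_mono sigma, simp)+
    then have "real n * s ^ l / 2 \<le> \<omega>" "\<omega> \<le> 2 * real l * (real n * s ^ l)"
      by (simp_all add: mult_ac)
    moreover have "2 * real l * (real n * s ^ l) \<le> 2 * real l * (2 * K)"
      using K_bounds by (intro mult_left_mono) auto
    ultimately have \<omega>: "K / 4 \<le> \<omega>" "\<omega> \<le> 4 * real l * K"
      using K_bounds by (simp_all add: mult_ac)
    have \<omega>1: "\<omega> \<ge> 1" using \<omega> K by simp
    have \<epsilon>: "\<epsilon> > 0" "\<epsilon> \<le> 1" "\<epsilon>\<^sup>2 = 1 / \<omega>"
      using \<omega>1 by (simp_all add: \<epsilon>_def \<omega>_def[symmetric] power_divide)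
    have "\<epsilon>\<^sup>2 \<le> 4 / K"
      unfolding \<epsilon>(3) using \<omega> K \<omega>1 by (simp add: field_simps)
    then have \<epsilon>_pow: "\<epsilon> ^ (2 * N + 2) \<le> (4 / K) ^ (N + 1)"
      using power_mono[of "\<epsilon>\<^sup>2" "4 / K" "N + 1"]
      by (simp only: power_mult[symmetric] distrib_left mult_1_right zero_le_power2)
    have \<psi>_holo: "\<psi> holomorphic_on cball 0 1"
      unfolding \<psi>_def by (intro holomorphic_intros phi_holo)
    have \<psi>_bd: "norm (\<psi> z) \<le> M + 1" if "norm z \<le> 1" for z
      using phi_bd[OF that] norm_triangle_ineq4[of "phi f s z" 1] by (simp add: \<psi>_def)
    have \<psi>0: "\<psi> 0 = 0" by (simp add: \<psi>_def phi_def)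
    have \<psi>_fps: "\<psi> has_fps_expansion fps_expansion \<psi> 0"
      using holomorphic_on_subset[OF \<psi>_holo, of "ball 0 1"] by (intro has_fps_expansion_fps_expansion[of "ball 0 1"]) auto
    have \<psi>_half: "norm (\<psi> z) \<le> 1 / 2" if "norm z \<le> \<eta>" for z
    proof -
      have "norm (\<psi> z - (\<Sum>j<1. fps_nth (fps_expansion \<psi> 0) j * z ^ j)) \<le> 2 * (M + 1) * (norm z / 1) ^ 1"
        by (rule norm_taylor_remainder_le[OF \<psi>_holo zero_less_one \<psi>_bd \<psi>_fps]) (use that \<eta> \<eta>_le in auto)
      also have "\<dots> \<le> 2 * (M + 1) * \<eta>"
        using that M by (simp add: mult_left_mono)
      finally show ?thesis
        using \<eta>(3) \<psi>0 fps_nth_fps_expansion[OF \<psi>_fps, of 0] by simp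
    qed
    have first: "norm (G - (1 + (\<Sum>\<nu> = 1..N. c_coeff f s \<nu> / of_nat (k n) ^ \<nu>))) \<le> \<bar>C\<bar> * (4 / K) ^ (N + 1)"
    proof -
      have coeff_eq: "saddle_coeff \<psi> \<nu> * of_real \<epsilon> ^ (2 * \<nu>) = c_coeff f s \<nu> / of_nat (k n) ^ \<nu>" for \<nu>
        unfolding \<psi>_def \<epsilon>_def using saddle_coeff_phi_eq_c_coeff[OF n _ pos] K by (simp add: K_def)
      have "c_coeff f s 0 = 1" by (simp add: c_coeff_def phi_def)
      then have "(\<Sum>\<nu>\<le>N. saddle_coeff \<psi> \<nu> * of_real \<epsilon> ^ (2 * \<nu>)) = 1 + (\<Sum>\<nu> = 1..N. c_coeff f s \<nu> / of_nat (k n) ^ \<nu>)"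
        unfolding coeff_eq by (simp add: atMost_atLeast0 sum.atLeast_Suc_atMost)
      then have "norm (G - (1 + (\<Sum>\<nu> = 1..N. c_coeff f s \<nu> / of_nat (k n) ^ \<nu>))) \<le> C * \<epsilon> ^ (2 * N + 2)"
        using C[OF \<psi>_holo _ \<psi>0 _ \<epsilon>(1,2)] \<psi>_bd \<psi>_half by (simp add: G_def)
      also have "\<dots> \<le> \<bar>C\<bar> * (4 / K) ^ (N + 1)"
        using \<epsilon>_pow \<epsilon> by (intro mult_mono) auto
      finally show ?thesis .
    qed
    have "norm (A - G) \<le> sqrt (real n * sigma_f f s / (2 * pi)) * (2 * pi * exp (- real n * (c * s ^ L)))"
      unfolding A_def G_def \<psi>_def \<epsilon>_def s_def[symmetric]
    proof (rule coefficient_minus_saddle_integral_le[OF f0 s rads n _ pos(2) \<eta>(1) \<eta>_le(2)])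
      show "real (k n) = real n * mu_f f s" using K by (simp add: K_def)
      show "arc_sum (fps_nth (log_fps f)) s \<theta> \<le> - (c * s ^ L)" if "\<eta> \<le> \<bar>\<theta>\<bar>" "\<bar>\<theta>\<bar> \<le> pi" for \<theta>
        using elim(2) that by (simp add: s_def)
    qed (use phi_eq \<eta>_le in auto)
    also have "\<dots> = (sqrt (\<omega> / (2 * pi)) * (2 * pi)) * exp (- real n * (c * s ^ L))"
      by (simp add: \<omega>_def)
    also have "\<dots> \<le> (8 * pi * real l * K) * exp (- (a * real n powr \<kappa>))"
    proof (rule mult_mono)
      have "sqrt (\<omega> / (2 * pi)) \<le> sqrt (\<omega>\<^sup>2)"
      proof (rule real_sqrt_le_mono)
        have "\<omega> / (2 * pi) \<le> \<omega> / 1"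
          using \<omega>1 pi_gt3 by (intro divide_left_mono) auto
        also have "\<dots> \<le> \<omega>\<^sup>2" using \<omega>1 by (simp add: power2_eq_square)
        finally show "\<omega> / (2 * pi) \<le> \<omega>\<^sup>2" .
      qed
      then have "sqrt (\<omega> / (2 * pi)) * (2 * pi) \<le> (4 * real l * K) * (2 * pi)"
        using \<omega> \<omega>1 by (intro mult_right_mono) auto
      then show "sqrt (\<omega> / (2 * pi)) * (2 * pi) \<le> 8 * pi * real l * K" by simp
      have "a * real n powr \<kappa> \<le> real n * (c * s ^ L)"
      proof -
        have "c1 / 2 * real n powr (\<delta> - 1) \<le> s ^ l"
        proof -
          have "c1 * real n powr \<delta> \<le> 2 * (real n * s ^ l)"
            using elim(4) K_bounds by (simp add: K_def)
          moreover have "real n powr \<delta> = real n powr (\<delta> - 1) * real n"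
            using n by (simp add: powr_diff)
          ultimately have "(c1 / 2 * real n powr (\<delta> - 1)) * real n \<le> s ^ l * real n"
            by (simp add: mult_ac)
          then show ?thesis using n by simp
        qed
        then have "(c1 / 2 * real n powr (\<delta> - 1)) powr (real L / real l) \<le> (s ^ l) powr (real L / real l)"
          using c1 by (intro powr_mono2) auto
        also have "(s ^ l) powr (real L / real l) = s ^ L"
          using s l0 by (simp add: powr_powr powr_realpow[symmetric])
        finally have "(c1 / 2) powr (real L / real l) * real n powr ((\<delta> - 1) * (real L / real l)) \<le> s ^ L"
          using c1(1) by (simp add: powr_mult powr_powr del: times_divide_eq_left)
        then have "real n * (c * ((c1 / 2) powr (real L / real l) * real n powr ((\<delta> - 1) * (real L / real l)))) \<le> real n * (c * s ^ L)"
          using c by (intro mult_left_mono) auto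
        moreover have "real n powr \<kappa> = real n * real n powr ((\<delta> - 1) * (real L / real l))"
        proof -
          have "\<kappa> = 1 + (\<delta> - 1) * (real L / real l)"
            using mult_minus_left[of "1 - \<delta>" "real L / real l"] unfolding \<kappa>_def minus_diff_eq by linarith
          then show ?thesis using n by (simp add: powr_add)
        qed
        ultimately show ?thesis by (simp add: a_def mult_ac)
      qed
      then show "exp (- real n * (c * s ^ L)) \<le> exp (- (a * real n powr \<kappa>))" by simp
    qed (use K in auto)
    also have "\<dots> = 8 * pi * real l * (K ^ (N + 2) * exp (- (a * real n powr \<kappa>))) / K ^ (N + 1)"
      using K by (simp add: field_simps)
    also have "\<dots> \<le> 8 * pi * real l * (c2 ^ (N + 2) * B) / K ^ (N + 1)"
    proof (intro divide_right_mono mult_left_mono)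
      have "K ^ (N + 2) \<le> (c2 * real n powr \<delta>) ^ (N + 2)"
        using elim(5) K by (intro power_mono) (auto simp: K_def)
      also have "\<dots> = c2 ^ (N + 2) * real n powr (\<delta> * real (N + 2))"
        using powr_realpow[of "real n powr \<delta>" "N + 2"] n by (simp only: power_mult_distrib powr_powr) simp
      finally have "K ^ (N + 2) * exp (- (a * real n powr \<kappa>)) \<le> c2 ^ (N + 2) * real n powr (\<delta> * real (N + 2)) * exp (- (a * real n powr \<kappa>))"
        by (rule mult_right_mono) simp
      also have "\<dots> \<le> c2 ^ (N + 2) * B"
        using mult_left_mono[OF elim(7), of "c2 ^ (N + 2)"] c2(1) by (simp add: mult_ac)
      finally show "K ^ (N + 2) * exp (- (a * real n powr \<kappa>)) \<le> c2 ^ (N + 2) * B" .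
    qed (use K in auto)
    finally have second: "norm (A - G) \<le> 8 * pi * real l * c2 ^ (N + 2) * B / K ^ (N + 1)"
      by (simp add: mult_ac)
    have "norm (A - (1 + (\<Sum>\<nu> = 1..N. c_coeff f s \<nu> / of_nat (k n) ^ \<nu>))) \<le>
          norm (A - G) + norm (G - (1 + (\<Sum>\<nu> = 1..N. c_coeff f s \<nu> / of_nat (k n) ^ \<nu>)))"
      using norm_triangle_ineq[of "A - G" "G - (1 + (\<Sum>\<nu> = 1..N. c_coeff f s \<nu> / of_nat (k n) ^ \<nu>))"]
      by (simp only: add_diff_eq diff_add_cancel)
    also have "\<dots> \<le> 8 * pi * real l * c2 ^ (N + 2) * B / K ^ (N + 1) + \<bar>C\<bar> * (4 / K) ^ (N + 1)"
      using first second by (rule add_mono[rotated])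
    also have "\<dots> = (\<bar>C\<bar> * 4 ^ (N + 1) + 8 * pi * real l * c2 ^ (N + 2) * B) * (1 / K ^ (N + 1))"
      by (simp only: power_divide) (simp add: add_divide_distrib)
    also have "1 / K ^ (N + 1) = norm (1 / complex_of_nat (k n) ^ (N + 1))"
      by (simp only: norm_divide norm_power norm_of_nat norm_one K_def)
    finally show ?case
      by (simp only: A_def s_def)
  qed
  then show "(\<lambda>n. complex_of_real
               (r n ^ k n * sqrt (2 * pi * real n * sigma_f f (r n)) *
                (fps_nth (f ^ n) (k n) / eval_fps f (r n) ^ n))
             - (1 + (\<Sum>\<nu> = 1..N. c_coeff f (r n) \<nu> / of_nat (k n) ^ \<nu>)))
           \<in> O(\<lambda>n. 1 / of_nat (k n) ^ (N + 1))"
    by (rule bigoI)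
qed

end
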